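(* Let $p\ge 2$ be an integer, let $f:\mathbb{E}\to\mathbb{R}$ be convex and $p$-times differentiable with a global minimizer $x^*$, and let $\nu\in[0,1]$ be such that $H_{f,p}(\nu)<+\infty$. Let $x_0\in\mathbb{E}$ and suppose there is $D_0\in(1,+\infty)$ with $\max_{x\in\mathcal{L}(x_0)}\|x-x^*\|\le D_0$, where $\mathcal{L}(x_0)=\{x\in\mathbb{E}: f(x)\le f(x_0)\}$. Let $\alpha=\nu$ (case "$\nu$ known") or $\alpha=1$ (case "$\nu$ unknown"). Given $\epsilon\in(0,1)$, assume that $\{x_t\}_{t=0}^T$ is a sequence generated by the Adaptive Tensor Method (Algorithm 2, described in the context) with parameters $\alpha$, $H_0>0$, $\theta\ge0$, such that $$f(x_0)-f(x^* )\ge\epsilon\quad\text{and}\quad f(x_{t,i}^+)-f(x^* )\ge\epsilon,\qquad i=0,\ldots,i_t,\ t=0,\ldots,T.$$ Denote by $m$ the first iteration number such that $$f(x_m)-f(x^* )\le[8(p+1)!]^{p+\alpha-1}\,4\max\{H_0,N_\nu(\epsilon)\}D_0^{p+\alpha},$$ and assume $m<T$. Then $$m\le\frac{1}{\ln\left(\frac{p+\alpha}{p+\alpha-1}\right)}\ln\max\left\{1,\ \log_2\frac{f(x_0)-f(x^* )}{[8(p+1)!]^{p+\alpha-1}\,2\max\{H_0,N_\nu(\epsilon)\}D_0^{p+\alpha}}\right\}$$ and $$f(x_T)-f(x^* )\le\frac{[24p(p+1)!]^{p+\alpha-1}\,2\max\{H_0,N_\nu(\epsilon)\}D_0^{p+\alpha}}{(T-m)^{p+\alpha-1}}.$$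 Consequently, $$T\le m+\kappa_1^{(\nu)}\,[24p(p+1)!]\,\epsilon^{-\frac{1}{p+\nu-1}},$$ where, if $\nu$ is known ($\alpha=\nu$), $$\kappa_1^{(\nu)}=\left(2\max\left\{H_0,\tfrac{3H_{f,p}(\nu)}{2},3\theta(p-1)!\right\}D_0^{p+\nu}\right)^{\frac1{p+\nu-1}},$$ and, if $\nu$ is unknown ($\alpha=1$), $$\kappa_1^{(\nu)}=\left(2\max\left\{H_0,\theta,\left(\tfrac{3H_{f,p}(\nu)}{2}\right)^{\frac{p}{p+\nu-1}}(4D_0)^{\frac{1-\nu}{p+\nu-1}}\right\}D_0^{p+1}\right)^{\frac1p}.$$
   Context: $\mathbb{E}$ is a finite-dimensional real vector space with dual $\mathbb{E}^*$; $B:\mathbb{E}\to\mathbb{E}^*$ is a self-adjoint positive definite operator, $\|x\|=\langle Bx,x\rangle^{1/2}$ on $\mathbb{E}$ and $\|s\|_*=\langle s,B^{-1}s\rangle^{1/2}$ on $\mathbb{E}^*$. For symmetric $p$-linear forms the norm is $\|D^pf(x)-D^pf(y)\|=\max_{\|h\|\le1}|D^pf(x)[h]^p-D^pf(y)[h]^p|$. The Hölder constant is $$H_{f,p}(\nu)=\sup_{x\ne y}\frac{\|D^pf(x)-D^pf(y)\|}{\|x-y\|^\nu},\qquad 0\le\nu\le1.$$ $\Phi_{x,p}(y)=f(x)+\sum_{i=1}^p\frac1{i!}D^if(x)[y-x]^i$, and $\Omega^{(\alpha)}_{x,p,H}(y)=\Phi_{x,p}(y)+\frac{H}{p!}\|y-x\|^{p+\alpha}$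 for $H>0$, $\alpha\in[0,1]$. Adaptive Tensor Method (Algorithm 2). Given $x_0\in\mathbb{E}$, $H_0>0$, $\theta\ge0$ and $\alpha$. At iteration $t\ge0$, for $i=0,1,2,\ldots$ successively, compute a point $x_{t,i}^+$ such that $$\Omega^{(\alpha)}_{x_t,p,2^iH_t}(x_{t,i}^+)\le f(x_t),\qquad\|\nabla\Omega^{(\alpha)}_{x_t,p,2^iH_t}(x_{t,i}^+)\|_*\le\theta\|x_{t,i}^+-x_t\|^{p+\alpha-1};$$ let $i_t$ be the first $i$ for which $$f(x_t)-f(x_{t,i}^+)\ge\frac{1}{8(p+1)!\,(2^iH_t)^{\frac1{p+\alpha-1}}}\|\nabla f(x_{t,i}^+)\|_*^{\frac{p+\alpha}{p+\alpha-1}};$$ then set $x_{t+1}=x_{t,i_t}^+$ and $H_{t+1}=2^{i_t-1}H_t$. The function $N_\nu(\epsilon)$ is: if $\alpha=\nu$ ($\nu$ known), $N_\nu(\epsilon)=\max\{\frac{3H_{f,p}(\nu)}{2},3\theta(p-1)!\}$; if $\alpha=1$ ($\nu$ unknown), $$N_\nu(\epsilon)=\max\left\{\theta,\left(\tfrac{3H_{f,p}(\nu)}{2}\right)^{\frac p{p+\nu-1}}\left(\tfrac{4R(\epsilon)}{\epsilon}\right)^{\frac{1-\nu}{p+\nu-1}}\right\},$$ where $R(\epsilon)=\max\{\|x-x^*\|: x\in\mathbb{E},\ f(x)\le f(x^* )+\epsilon\}$.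
   Formalization: The bound on m is proved with its right-hand side rounded up to the next integer; without rounding the printed inequality can fail by less than one, e.g. when f(x_0)-f(x* ) only slightly exceeds the threshold defining m. *)

theory Defs
  imports "HOL-Analysis.Analysis"
begin

text \<open>
  The space E is a type of class \<open>euclidean_space\<close> and its dual is the type of bounded linear
  functionals. The norm and inner product of the type class only supply the topology (which on a
  finite-dimensional space does not depend on them); all metric quantities below are taken with
  respect to the operator B.
\<close>

definition self_adjoint_pos_def :: "('a::euclidean_space \<Rightarrow> ('a \<Rightarrow>\<^sub>L real)) \<Rightarrow> bool" where
  "self_adjoint_pos_def B \<longleftrightarrow> linear B
     \<and> (\<forall>x y. blinfun_apply (B x) y = blinfun_apply (B y) x)
     \<and> (\<forall>x. x \<noteq> 0 \<longrightarrow> blinfun_apply (B x) x > 0)"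

definition primal_norm :: "('a::euclidean_space \<Rightarrow> ('a \<Rightarrow>\<^sub>L real)) \<Rightarrow> 'a \<Rightarrow> real" where
  "primal_norm B x = sqrt (blinfun_apply (B x) x)"

definition dual_norm :: "('a::euclidean_space \<Rightarrow> ('a \<Rightarrow>\<^sub>L real)) \<Rightarrow> ('a \<Rightarrow>\<^sub>L real) \<Rightarrow> real" where
  "dual_norm B s = sqrt (blinfun_apply s (inv B s))"

definition grad :: "('a::euclidean_space \<Rightarrow> real) \<Rightarrow> 'a \<Rightarrow> ('a \<Rightarrow>\<^sub>L real)" where
  "grad f x = Blinfun (frechet_derivative f (at x))"

text \<open>
  A k-linear form is encoded by its values on lists of k directions, so that
  \<open>higher_deriv f [h1, ..., hk] x\<close> is the iterated Frechet derivative
  \<open>D^k f(x)[h1, ..., hk]\<close>. As E is finite-dimensional, the map \<open>D^k f\<close> into the space of k-linear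
  forms is (totally) differentiable at a point iff all of its evaluations at k fixed directions are.
\<close>

primrec higher_deriv :: "('a::euclidean_space \<Rightarrow> real) \<Rightarrow> 'a list \<Rightarrow> 'a \<Rightarrow> real" where
  "higher_deriv f [] = f"
| "higher_deriv f (h # hs) = (\<lambda>x. frechet_derivative (higher_deriv f hs) (at x) h)"

definition times_differentiable :: "nat \<Rightarrow> ('a::euclidean_space \<Rightarrow> real) \<Rightarrow> bool" where
  "times_differentiable p f \<longleftrightarrow>
     (\<forall>hs x. length hs < p \<longrightarrow> higher_deriv f hs differentiable (at x))"

text \<open>For a p-linear form the set is bounded and the supremum is a maximum.\<close>

definition sym_form_norm ::
    "('a::euclidean_space \<Rightarrow> ('a \<Rightarrow>\<^sub>L real)) \<Rightarrow> nat \<Rightarrow> ('a list \<Rightarrow> real) \<Rightarrow> real" where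
  "sym_form_norm B p P = Sup {\<bar>P (replicate p h)\<bar> | h. primal_norm B h \<le> 1}"

definition holder_const ::
    "('a::euclidean_space \<Rightarrow> ('a \<Rightarrow>\<^sub>L real)) \<Rightarrow> ('a \<Rightarrow> real) \<Rightarrow> nat \<Rightarrow> real \<Rightarrow> ereal" where
  "holder_const B f p \<nu> =
     Sup {ereal (sym_form_norm B p (\<lambda>hs. higher_deriv f hs x - higher_deriv f hs y)
                 / primal_norm B (x - y) powr \<nu>) | x y. x \<noteq> y}"

definition taylor :: "('a::euclidean_space \<Rightarrow> real) \<Rightarrow> nat \<Rightarrow> 'a \<Rightarrow> 'a \<Rightarrow> real" where
  "taylor f p x y = f x + (\<Sum>i=1..p. 1 / fact i * higher_deriv f (replicate i (y - x)) x)"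

definition reg_model ::
    "('a::euclidean_space \<Rightarrow> ('a \<Rightarrow>\<^sub>L real)) \<Rightarrow> ('a \<Rightarrow> real) \<Rightarrow> nat \<Rightarrow> real \<Rightarrow> real \<Rightarrow> 'a \<Rightarrow> 'a \<Rightarrow> real" where
  "reg_model B f p \<alpha> H x y =
     taylor f p x y + H / fact p * primal_norm B (y - x) powr (real p + \<alpha>)"

definition trial_point ::
    "('a::euclidean_space \<Rightarrow> ('a \<Rightarrow>\<^sub>L real)) \<Rightarrow> ('a \<Rightarrow> real) \<Rightarrow> nat \<Rightarrow> real \<Rightarrow> real \<Rightarrow> real \<Rightarrow> 'a \<Rightarrow> 'a \<Rightarrow> bool" where
  "trial_point B f p \<alpha> \<theta> H x y \<longleftrightarrow>
     reg_model B f p \<alpha> H x y \<le> f x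
     \<and> dual_norm B (grad (reg_model B f p \<alpha> H x) y)
         \<le> \<theta> * primal_norm B (y - x) powr (real p + \<alpha> - 1)"

definition sufficient_decrease ::
    "('a::euclidean_space \<Rightarrow> ('a \<Rightarrow>\<^sub>L real)) \<Rightarrow> ('a \<Rightarrow> real) \<Rightarrow> nat \<Rightarrow> real \<Rightarrow> real \<Rightarrow> 'a \<Rightarrow> 'a \<Rightarrow> bool" where
  "sufficient_decrease B f p \<alpha> H x y \<longleftrightarrow>
     f x - f y \<ge> 1 / (8 * fact (p + 1) * H powr (1 / (real p + \<alpha> - 1)))
       * dual_norm B (grad f y) powr ((real p + \<alpha>) / (real p + \<alpha> - 1))"

text \<open>
  Iterations 0, ..., T of the Adaptive Tensor Method: \<open>x t\<close> and \<open>H t\<close> are the iterates and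
  regularization parameters, \<open>xp t i\<close> is the i-th trial point at iteration t (only
  \<open>i \<le> it t\<close> is computed), and \<open>it t\<close> is the index of the first accepted one.
\<close>

definition adaptive_tensor_method ::
    "('a::euclidean_space \<Rightarrow> ('a \<Rightarrow>\<^sub>L real)) \<Rightarrow> ('a \<Rightarrow> real) \<Rightarrow> nat \<Rightarrow> real \<Rightarrow> real \<Rightarrow> real \<Rightarrow> 'a \<Rightarrow> nat
      \<Rightarrow> (nat \<Rightarrow> 'a) \<Rightarrow> (nat \<Rightarrow> real) \<Rightarrow> (nat \<Rightarrow> nat \<Rightarrow> 'a) \<Rightarrow> (nat \<Rightarrow> nat) \<Rightarrow> bool" where
  "adaptive_tensor_method B f p \<alpha> \<theta> H0 x0 T x H xp it \<longleftrightarrow>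
     x 0 = x0 \<and> H 0 = H0
     \<and> (\<forall>t\<le>T.
          (\<forall>i\<le>it t. trial_point B f p \<alpha> \<theta> (2 ^ i * H t) (x t) (xp t i))
          \<and> sufficient_decrease B f p \<alpha> (2 ^ it t * H t) (x t) (xp t (it t))
          \<and> (\<forall>i<it t. \<not> sufficient_decrease B f p \<alpha> (2 ^ i * H t) (x t) (xp t i)))
     \<and> (\<forall>t<T. x (Suc t) = xp t (it t)
          \<and> H (Suc t) = 2 powi (int (it t) - 1) * H t)"

text \<open>
  The supremum is an attained maximum whenever f is continuous with bounded sublevel set
  \<open>{x. f x \<le> f xs + \<epsilon>}\<close>; it is not meaningful if that set is unbounded.
\<close>

definition level_radius ::
    "('a::euclidean_space \<Rightarrow> ('a \<Rightarrow>\<^sub>L real)) \<Rightarrow> ('a \<Rightarrow> real) \<Rightarrow> 'a \<Rightarrow> real \<Rightarrow> real" where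
  "level_radius B f xs \<epsilon> = Sup {primal_norm B (x - xs) | x. f x \<le> f xs + \<epsilon>}"

text \<open>
  The flag \<open>known\<close> distinguishes the two variants (\<open>\<alpha> = \<nu>\<close> and \<open>\<alpha> = 1\<close>); it cannot be
  recovered from \<open>\<alpha>\<close> and \<open>\<nu>\<close>, because for \<open>\<nu> = 1\<close> the two variants have the same \<open>\<alpha>\<close> but
  different constants.
\<close>

definition N_const ::
    "bool \<Rightarrow> ('a::euclidean_space \<Rightarrow> ('a \<Rightarrow>\<^sub>L real)) \<Rightarrow> ('a \<Rightarrow> real) \<Rightarrow> nat \<Rightarrow> real \<Rightarrow> real \<Rightarrow> 'a \<Rightarrow> real \<Rightarrow> real" where
  "N_const known B f p \<nu> \<theta> xs \<epsilon> =
     (let Hf = real_of_ereal (holder_const B f p \<nu>) in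
      if known then max (3 * Hf / 2) (3 * \<theta> * fact (p - 1))
      else max \<theta> ((3 * Hf / 2) powr (real p / (real p + \<nu> - 1))
                  * (4 * level_radius B f xs \<epsilon> / \<epsilon>) powr ((1 - \<nu>) / (real p + \<nu> - 1))))"

definition kappa1 ::
    "bool \<Rightarrow> ('a::euclidean_space \<Rightarrow> ('a \<Rightarrow>\<^sub>L real)) \<Rightarrow> ('a \<Rightarrow> real) \<Rightarrow> nat \<Rightarrow> real \<Rightarrow> real \<Rightarrow> real \<Rightarrow> real \<Rightarrow> real" where
  "kappa1 known B f p \<nu> \<theta> H0 D0 =
     (let Hf = real_of_ereal (holder_const B f p \<nu>) in
      if known then
        (2 * max H0 (max (3 * Hf / 2) (3 * \<theta> * fact (p - 1))) * D0 powr (real p + \<nu>))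
          powr (1 / (real p + \<nu> - 1))
      else
        (2 * max H0 (max \<theta> ((3 * Hf / 2) powr (real p / (real p + \<nu> - 1))
                             * (4 * D0) powr ((1 - \<nu>) / (real p + \<nu> - 1)))) * D0 ^ (p + 1))
          powr (1 / real p))"

end

theory Submission
  imports Defs
begin

text \<open>
  A \<open>p\<close>-th derivative is a symmetric multilinear form, so polarization bounds its mixed values by
  \<open>p ^ p / p!\<close> times its diagonal norm. (The sharp constant is 1, but the factorials in the acceptance
  test leave enough room.) With Taylor's formula along segments this shows that a trial point passes
  the test as soon as its regularization parameter is at least \<open>N\<close>; for \<open>\<alpha> = 1\<close> this also needs the
  gradient bound \<open>\<epsilon> / R(\<epsilon>)\<close>, which keeps the steps from being too short. Hence the accepted parameters
  are at most \<open>2 * max H0 N\<close>, and the suitably scaled residuals satisfy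
  \<open>u (t + 1) + u (t + 1) powr (1 + 1 / q) \<le> u t\<close> with \<open>q = p + \<alpha> - 1\<close>. While \<open>u > 2\<close> the logarithm of
  \<open>u\<close> contracts geometrically; afterwards \<open>u powr (- (1 / q))\<close> grows by at least \<open>1 / (3 * q)\<close> per step.
\<close>

section \<open>The norms induced by a positive definite operator\<close>

text \<open>The \<open>p\<close>-th derivative is only assumed to exist and may be discontinuous for
  \<nu> = 0. So its symmetry is derived from differentiability, at one point, of the derivatives one
  order lower, and Taylor's formula is used with Lagrange remainder, which gives the plain error
  constant \<open>Hf / fact p\<close>. The Hoelder constant controls diagonal values only, while the
  gradient of the Taylor error has one free direction; this is where polarization is spent.

  The room in the acceptance test is explicit. With s = p + \<alpha>, a trial step of length r
  lowers f by at least H r^s / (3 p!), and the new gradient is at most K H r^(s-1). Eliminating r,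
  the test with 8 (p+1)! passes once K^(s/(s-1)) \<le> 8 (p+1) / 3. The factor 3/2 in
  \<open>N\<close> is what leaves a third of H after subtracting the Taylor error. For s \<ge> 3 the
  bound K \<le> 4 is enough; for p = 2 and \<alpha> < 1 the exponent exceeds 3/2 and K has to be
  evaluated exactly.\<close>

lemma pos_def_dual_surj:
  assumes B: "self_adjoint_pos_def B"
  shows "\<exists>v. B v = s"
proof -
  \<comment> \<open>Reading a functional through its coordinates turns \<open>B\<close> into an
    endomorphism of \<open>'a\<close>. Positivity makes it injective, hence surjective by
    dimension.\<close>
  define b where "b v = (\<Sum>i\<in>Basis. blinfun_apply (B v) i *\<^sub>R i)" for v
  have lin: "linear B" and pos: "\<And>x. x \<noteq> 0 \<Longrightarrow> blinfun_apply (B x) x > 0"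
    using B by (auto simp: self_adjoint_pos_def_def)
  have rep: "blinfun_apply t y = (\<Sum>i\<in>Basis. blinfun_apply t i *\<^sub>R i) \<bullet> y" for t :: "'a \<Rightarrow>\<^sub>L real" and y
  proof -
    have "blinfun_apply t y = blinfun_apply t (\<Sum>i\<in>Basis. (y \<bullet> i) *\<^sub>R i)"
      by (simp add: euclidean_representation)
    also have "\<dots> = (\<Sum>i\<in>Basis. (y \<bullet> i) * blinfun_apply t i)"
      by (simp add: blinfun.sum_right blinfun.scaleR_right)
    also have "\<dots> = (\<Sum>i\<in>Basis. blinfun_apply t i *\<^sub>R i) \<bullet> y"
      by (simp add: inner_sum_left inner_commute[of y] mult.commute)
    finally show ?thesis .
  qed
  have linb: "linear b"
    unfolding b_def using lin
    by (auto intro!: linearI simp: linear_add linear_scale blinfun.add_left blinfun.scaleR_left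
        scaleR_add_left sum.distrib scaleR_sum_right)
  have "inj b"
  proof (subst linear_injective_0[OF linb], intro allI impI)
    fix x assume "b x = 0"
    then have "blinfun_apply (B x) x = 0"
      using rep[of "B x" x] by (simp add: b_def)
    then show "x = 0" using pos[of x] by auto
  qed
  then have "surj b"
    using linear_injective_imp_surjective[OF linb] by simp
  then obtain v where v: "(\<Sum>i\<in>Basis. blinfun_apply s i *\<^sub>R i) = b v" by (metis surjD)
  have "B v = s"
    by (rule blinfun_eqI, subst rep[of "B v"], subst rep[of s]) (simp add: v b_def)
  then show ?thesis by blast
qed

locale pos_def_operator =
  fixes B :: "'a::euclidean_space \<Rightarrow> ('a \<Rightarrow>\<^sub>L real)"
  assumes pd: "self_adjoint_pos_def B"
begin

abbreviation nrm ("\<parallel>_\<parallel>") where "\<parallel>x\<parallel> \<equiv> primal_norm B x"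

abbreviation bil ("\<langle>_,_\<rangle>") where "\<langle>x,y\<rangle> \<equiv> blinfun_apply (B x) y"

lemma lin: "linear B" and sym: "\<langle>x,y\<rangle> = \<langle>y,x\<rangle>" and pos: "x \<noteq> 0 \<Longrightarrow> \<langle>x,x\<rangle> > 0"
  using pd by (auto simp: self_adjoint_pos_def_def)

lemma bil_simps:
  "\<langle>x + y,z\<rangle> = \<langle>x,z\<rangle> + \<langle>y,z\<rangle>" "\<langle>c *\<^sub>R x,z\<rangle> = c * \<langle>x,z\<rangle>" "\<langle>x - y,z\<rangle> = \<langle>x,z\<rangle> - \<langle>y,z\<rangle>" "\<langle>- x,z\<rangle> = - \<langle>x,z\<rangle>"
  "\<langle>x,y + z\<rangle> = \<langle>x,y\<rangle> + \<langle>x,z\<rangle>" "\<langle>x,c *\<^sub>R z\<rangle> = c * \<langle>x,z\<rangle>" "\<langle>x,y - z\<rangle> = \<langle>x,y\<rangle> - \<langle>x,z\<rangle>" "\<langle>x,- z\<rangle> = - \<langle>x,z\<rangle>"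
  "\<langle>0,z\<rangle> = 0" "\<langle>x,0\<rangle> = 0"
  using lin
  by (simp_all add: linear_add linear_scale linear_diff linear_neg linear_0 blinfun.add_left
      blinfun.scaleR_left blinfun.diff_left blinfun.minus_left blinfun.add_right blinfun.scaleR_right
      blinfun.diff_right blinfun.minus_right)

lemma bil_nonneg: "\<langle>x,x\<rangle> \<ge> 0"
  using pos[of x] by (cases "x = 0") (auto simp: bil_simps)

lemma nrm_nonneg [simp]: "\<parallel>x\<parallel> \<ge> 0"
  by (simp add: primal_norm_def bil_nonneg)

lemma nrm_sq: "\<parallel>x\<parallel>\<^sup>2 = \<langle>x,x\<rangle>"
  by (simp add: primal_norm_def bil_nonneg)

lemma nrm_0 [simp]: "\<parallel>0\<parallel> = 0"
  by (simp add: primal_norm_def bil_simps)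

lemma nrm_eq_0_iff [simp]: "\<parallel>x\<parallel> = 0 \<longleftrightarrow> x = 0"
  using pos[of x] by (cases "x = 0") (auto simp: primal_norm_def bil_simps)

lemma nrm_pos_iff: "\<parallel>x\<parallel> > 0 \<longleftrightarrow> x \<noteq> 0"
  using nrm_nonneg[of x] nrm_eq_0_iff[of x] by linarith

lemma nrm_scale: "\<parallel>c *\<^sub>R x\<parallel> = \<bar>c\<bar> * \<parallel>x\<parallel>"
  by (simp add: primal_norm_def bil_simps real_sqrt_mult flip: mult.assoc)

lemma nrm_minus: "\<parallel>- x\<parallel> = \<parallel>x\<parallel>"
  by (simp add: primal_norm_def bil_simps)

lemma nrm_minus_commute: "\<parallel>x - y\<parallel> = \<parallel>y - x\<parallel>"
  using nrm_minus[of "x - y"] by simp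

lemma cauchy_schwarz: "\<bar>\<langle>x,y\<rangle>\<bar> \<le> \<parallel>x\<parallel> * \<parallel>y\<parallel>"
proof (cases "y = 0")
  case True then show ?thesis by (simp add: bil_simps)
next
  case False
  define c where "c = \<langle>x,y\<rangle> / \<langle>y,y\<rangle>"
  have yy: "\<langle>y,y\<rangle> > 0" using pos False by simp
  have "0 \<le> \<langle>x - c *\<^sub>R y, x - c *\<^sub>R y\<rangle>" by (rule bil_nonneg)
  also have "\<dots> = \<langle>x,x\<rangle> - 2 * c * \<langle>x,y\<rangle> + c * c * \<langle>y,y\<rangle>"
    using sym[of y x] by (simp add: bil_simps algebra_simps)
  also have "\<dots> = \<langle>x,x\<rangle> - \<langle>x,y\<rangle>\<^sup>2 / \<langle>y,y\<rangle>"
    using yy by (simp add: c_def power2_eq_square)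
  finally have "\<langle>x,y\<rangle>\<^sup>2 \<le> \<langle>x,x\<rangle> * \<langle>y,y\<rangle>"
    using yy by (simp add: field_simps)
  then have "\<bar>\<langle>x,y\<rangle>\<bar>\<^sup>2 \<le> (\<parallel>x\<parallel> * \<parallel>y\<parallel>)\<^sup>2"
    by (simp add: power_mult_distrib nrm_sq)
  then show ?thesis by (rule power2_le_imp_le) simp
qed

lemma nrm_triangle: "\<parallel>x + y\<parallel> \<le> \<parallel>x\<parallel> + \<parallel>y\<parallel>"
proof (rule power2_le_imp_le)
  have "\<parallel>x + y\<parallel>\<^sup>2 = \<parallel>x\<parallel>\<^sup>2 + 2 * \<langle>x,y\<rangle> + \<parallel>y\<parallel>\<^sup>2"
    using sym[of y x] by (simp add: nrm_sq bil_simps)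
  also have "\<dots> \<le> \<parallel>x\<parallel>\<^sup>2 + 2 * (\<parallel>x\<parallel> * \<parallel>y\<parallel>) + \<parallel>y\<parallel>\<^sup>2"
    using cauchy_schwarz[of x y] by simp
  finally show "\<parallel>x + y\<parallel>\<^sup>2 \<le> (\<parallel>x\<parallel> + \<parallel>y\<parallel>)\<^sup>2"
    by (simp add: power2_sum)
qed simp

lemma B_inv: "B (inv B s) = s"
  using pos_def_dual_surj[OF pd] by (metis f_inv_into_f rangeI)

lemma dual_norm_eq: "dual_norm B s = \<parallel>inv B s\<parallel>"
  by (simp add: dual_norm_def primal_norm_def B_inv)

lemma dual_norm_nonneg [simp]: "dual_norm B s \<ge> 0"
  by (simp add: dual_norm_eq)

lemma dual_norm_bound: "\<bar>blinfun_apply s u\<bar> \<le> dual_norm B s * \<parallel>u\<parallel>"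
  using cauchy_schwarz[of "inv B s" u] by (simp add: B_inv dual_norm_eq)

text \<open>The vector \<open>inv B s\<close> attains the dual norm, so testing there suffices once
  the norm is positive.\<close>

lemma dual_norm_le:
  assumes "\<And>v. blinfun_apply s v \<le> K * \<parallel>v\<parallel>"
  shows "dual_norm B s \<le> K"
proof (cases "dual_norm B s = 0")
  case True
  \<comment> \<open>The sign of \<open>K\<close> is not given; any nonzero test vector supplies
    it.\<close>
  obtain b :: 'a where "b \<in> Basis" using nonempty_Basis by blast
  then have b: "\<parallel>b\<parallel> > 0" using nonzero_Basis by (auto simp: nrm_pos_iff)
  have "0 \<le> K * \<parallel>b\<parallel>"
    using dual_norm_bound[of s b] assms[of b] True by simp
  then show ?thesis using b True by (simp add: zero_le_mult_iff)
next
  case False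
  then have p: "dual_norm B s > 0" using dual_norm_nonneg[of s] by linarith
  have "dual_norm B s * dual_norm B s = blinfun_apply s (inv B s)"
    using nrm_sq[of "inv B s"] by (simp add: dual_norm_eq B_inv power2_eq_square)
  also have "\<dots> \<le> K * dual_norm B s" using assms by (simp add: dual_norm_eq)
  finally show ?thesis using p by simp
qed

lemma bounded_bilinear_bil: "bounded_bilinear (\<lambda>x y. \<langle>x,y\<rangle>)"
proof -
  have "bounded_linear B" using lin by (simp add: linear_conv_bounded_linear)
  then show ?thesis
    by (rule bounded_bilinear.comp1[OF bounded_bilinear_blinfun_apply])
qed

text \<open>Frechet derivatives and boundedness are phrased with the norm of the type class, so both
  comparisons with the norm of \<open>B\<close> are needed.\<close>

lemma nrm_le_norm: "\<exists>c>0. \<forall>x. \<parallel>x\<parallel> \<le> c * norm x"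
proof -
  obtain K where K: "K > 0" "\<And>x y. norm \<langle>x,y\<rangle> \<le> norm x * norm y * K"
    using bounded_bilinear.pos_bounded[OF bounded_bilinear_bil] by blast
  have "\<parallel>x\<parallel> \<le> sqrt K * norm x" for x
  proof (rule power2_le_imp_le)
    show "\<parallel>x\<parallel>\<^sup>2 \<le> (sqrt K * norm x)\<^sup>2"
      using K(1) K(2)[of x x] by (simp add: nrm_sq power_mult_distrib power2_eq_square[of "norm x"] mult_ac)
  qed (use K in simp)
  then show ?thesis using K by (intro exI[of _ "sqrt K"]) auto
qed

text \<open>By compactness the quadratic form of \<open>B\<close> has a positive minimum on the unit
  sphere; homogeneity does the rest.\<close>

lemma norm_le_nrm: "\<exists>c>0. \<forall>x. norm x \<le> c * \<parallel>x\<parallel>"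
proof -
  have cont: "continuous_on (sphere 0 1) (\<lambda>x. \<langle>x,x\<rangle>)"
    by (intro bounded_bilinear.continuous_on[OF bounded_bilinear_bil] continuous_on_id)
  obtain b :: 'a where b: "b \<in> Basis" using nonempty_Basis by blast
  then have "b \<in> sphere 0 1" by simp
  then obtain z where z: "z \<in> sphere 0 1" "\<And>y. y \<in> sphere 0 1 \<Longrightarrow> \<langle>z,z\<rangle> \<le> \<langle>y,y\<rangle>"
    using continuous_attains_inf[OF compact_sphere _ cont] by blast
  have zp: "\<parallel>z\<parallel> > 0" using z(1) by (auto simp: nrm_pos_iff)
  have "norm x \<le> (1 / \<parallel>z\<parallel>) * \<parallel>x\<parallel>" for x
  proof (cases "x = 0")
    case False
    have "\<parallel>z\<parallel> \<le> \<parallel>(1 / norm x) *\<^sub>R x\<parallel>"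
      unfolding primal_norm_def using z(2)[of "(1 / norm x) *\<^sub>R x"] False by (intro real_sqrt_le_mono) simp
    then show ?thesis using zp False by (simp add: nrm_scale field_simps)
  qed simp
  then show ?thesis using zp by (intro exI[of _ "1 / \<parallel>z\<parallel>"]) auto
qed

end

section \<open>Symmetry of higher derivatives\<close>

lemma line_has_derivative:
  fixes g :: "'a::real_normed_vector \<Rightarrow> real"
  assumes "g differentiable (at (y + t *\<^sub>R h))"
  shows "((\<lambda>t. g (y + t *\<^sub>R h)) has_real_derivative frechet_derivative g (at (y + t *\<^sub>R h)) h) (at t)"
proof -
  have g: "(g has_derivative frechet_derivative g (at (y + t *\<^sub>R h))) (at (y + t *\<^sub>R h))"
    using assms by (simp add: frechet_derivative_works)
  have "((\<lambda>t. y + t *\<^sub>R h) has_derivative (\<lambda>s. s *\<^sub>R h)) (at t)"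
    by (auto intro!: derivative_eq_intros)
  from has_derivative_compose[OF this g]
  have "((\<lambda>t. g (y + t *\<^sub>R h)) has_derivative (\<lambda>s. frechet_derivative g (at (y + t *\<^sub>R h)) (s *\<^sub>R h))) (at t)" .
  moreover have "(\<lambda>s. frechet_derivative g (at (y + t *\<^sub>R h)) (s *\<^sub>R h)) = (*) (frechet_derivative g (at (y + t *\<^sub>R h)) h)"
    using linear_frechet_derivative[OF assms] by (auto simp: linear_scale)
  ultimately show ?thesis by (simp add: has_field_derivative_def)
qed

text \<open>The mean value theorem along \<open>u\<close> turns the second difference into a
  difference of two values of the first derivative, and both values are read off from its
  linearization at \<open>x\<close>. Continuity of second derivatives is thereby avoided.\<close>

lemma second_difference_limit:
  fixes g :: "'a::real_normed_vector \<Rightarrow> real"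
  assumes g: "\<And>z. g differentiable (at z)"
    and a: "(\<lambda>z. frechet_derivative g (at z) u) differentiable (at x)"
    and e: "e > 0"
  shows "\<exists>d>0. \<forall>t. 0 < t \<and> t < d \<longrightarrow>
    \<bar>(g (x + t *\<^sub>R u + t *\<^sub>R v) - g (x + t *\<^sub>R u) - g (x + t *\<^sub>R v) + g x) / t\<^sup>2
      - frechet_derivative (\<lambda>z. frechet_derivative g (at z) u) (at x) v\<bar> \<le> e"
proof -
  define A where "A = (\<lambda>z. frechet_derivative g (at z) u)"
  define A' where "A' = frechet_derivative A (at x)"
  \<comment> \<open>The displacements \<open>w1\<close>, \<open>w2\<close> below satisfy
    \<open>norm w1 + norm w2 \<le> t * c\<close>; the summand 1 keeps \<open>c\<close>
    positive.\<close>
  define c where "c = 2 * (norm u + norm v) + 1"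
  have c: "c > 0" by (simp add: c_def add_nonneg_pos)
  have A': "(A has_derivative A') (at x)"
    using a by (simp add: A'_def A_def frechet_derivative_works)
  then have lin: "linear A'" by (rule has_derivative_linear)
  from A'[unfolded has_derivative_at_alt] obtain d where d: "d > 0"
    "\<And>y. norm (y - x) < d \<Longrightarrow> norm (A y - A x - A' (y - x)) \<le> e / c * norm (y - x)"
    using e c by (metis divide_pos_pos)
  have err: "\<bar>A (x + w) - A x - A' w\<bar> \<le> e / c * norm w" if "norm w < d" for w
    using d(2)[of "x + w"] that by simp
  show ?thesis
  proof (intro exI[of _ "d / c"] conjI allI impI)
    show "d / c > 0" using d c by simp
    fix t :: real assume t: "0 < t \<and> t < d / c"
    then have tc: "t * c < d" using c by (simp add: field_simps)
    \<comment> \<open>The increment of \<open>k\<close> from 0 to 1 is exactly the second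
      difference.\<close>
    define k where "k s = g ((x + t *\<^sub>R v) + s *\<^sub>R (t *\<^sub>R u)) - g (x + s *\<^sub>R (t *\<^sub>R u))" for s
    have "\<exists>s. 0 < s \<and> s < 1 \<and> k 1 - k 0 = (1 - 0) * (t * A ((x + t *\<^sub>R v) + s *\<^sub>R (t *\<^sub>R u)) - t * A (x + s *\<^sub>R (t *\<^sub>R u)))"
    proof (rule MVT2)
      fix s :: real
      have "frechet_derivative g (at z) (t *\<^sub>R u) = t * A z" for z
        using linear_frechet_derivative[OF g[of z]] by (simp add: A_def linear_scale)
      then show "(k has_real_derivative (t * A ((x + t *\<^sub>R v) + s *\<^sub>R (t *\<^sub>R u)) - t * A (x + s *\<^sub>R (t *\<^sub>R u)))) (at s)"
        using DERIV_diff[OF line_has_derivative[OF g, where y = "x + t *\<^sub>R v" and t = s and h = "t *\<^sub>R u"]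
            line_has_derivative[OF g, where y = x and t = s and h = "t *\<^sub>R u"]]
        unfolding k_def by simp
    qed simp
    then obtain s where s: "0 < s" "s < 1"
      "k 1 - k 0 = t * (A ((x + t *\<^sub>R v) + s *\<^sub>R (t *\<^sub>R u)) - A (x + s *\<^sub>R (t *\<^sub>R u)))"
      by (auto simp: right_diff_distrib)
    define w1 where "w1 = t *\<^sub>R v + s *\<^sub>R (t *\<^sub>R u)"
    define w2 where "w2 = s *\<^sub>R (t *\<^sub>R u)"
    have n2: "norm w2 \<le> t * norm u"
      using s t by (simp add: w2_def mult_left_le_one_le)
    have n1: "norm w1 \<le> t * norm v + t * norm u"
      unfolding w1_def using n2[unfolded w2_def] t by (intro order_trans[OF norm_triangle_ineq]) simp
    have tcs: "t * c = 2 * t * norm u + 2 * t * norm v + t" by (simp add: c_def algebra_simps)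
    have nn: "t * norm u \<ge> 0" "t * norm v \<ge> 0" using t by auto
    have lt: "norm w1 < d" "norm w2 < d" using n1 n2 tc tcs nn t by linarith+
    have w12: "A' w1 - A' w2 = t * A' v"
      using lin by (simp add: w1_def w2_def linear_add linear_scale)
    have "\<bar>A (x + w1) - A (x + w2) - t * A' v\<bar> \<le> e / c * norm w1 + e / c * norm w2"
      using err[OF lt(1)] err[OF lt(2)] w12 by linarith
    also have "\<dots> = e / c * (norm w1 + norm w2)" by (simp add: distrib_left)
    also have "\<dots> \<le> e / c * (t * c)"
    proof (rule mult_left_mono)
      show "norm w1 + norm w2 \<le> t * c" using n1 n2 tcs nn t by linarith
    qed (use e c in simp)
    also have "\<dots> = e * t" using c by simp
    finally have "\<bar>A (x + w1) - A (x + w2) - t * A' v\<bar> / t \<le> e" using t by (simp add: field_simps)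
    moreover have "g (x + t *\<^sub>R u + t *\<^sub>R v) - g (x + t *\<^sub>R u) - g (x + t *\<^sub>R v) + g x = t * (A (x + w1) - A (x + w2))"
      using s(3) by (simp add: k_def w1_def w2_def add_ac)
    moreover have "t * (A (x + w1) - A (x + w2)) / t\<^sup>2 - A' v = (A (x + w1) - A (x + w2) - t * A' v) / t"
      using t by (simp add: power2_eq_square field_simps)
    ultimately show "\<bar>(g (x + t *\<^sub>R u + t *\<^sub>R v) - g (x + t *\<^sub>R u) - g (x + t *\<^sub>R v) + g x) / t\<^sup>2
      - frechet_derivative (\<lambda>z. frechet_derivative g (at z) u) (at x) v\<bar> \<le> e"
      using t by (simp add: A'_def A_def abs_divide)
  qed
qed

text \<open>Both sides are limits of the same quotient, which is symmetric in \<open>u\<close> and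
  \<open>v\<close>.\<close>

lemma symmetric_second_derivative:
  fixes g :: "'a::real_normed_vector \<Rightarrow> real"
  assumes g: "\<And>z. g differentiable (at z)"
    and u: "(\<lambda>z. frechet_derivative g (at z) u) differentiable (at x)"
    and v: "(\<lambda>z. frechet_derivative g (at z) v) differentiable (at x)"
  shows "frechet_derivative (\<lambda>z. frechet_derivative g (at z) u) (at x) v
       = frechet_derivative (\<lambda>z. frechet_derivative g (at z) v) (at x) u" (is "?a = ?b")
proof -
  have "\<bar>?a - ?b\<bar> \<le> e" if e: "e > 0" for e
  proof -
    from e have e2: "e / 2 > 0" by simp
    obtain d1 where d1: "d1 > 0" "\<And>t. 0 < t \<and> t < d1 \<Longrightarrow>
      \<bar>(g (x + t *\<^sub>R u + t *\<^sub>R v) - g (x + t *\<^sub>R u) - g (x + t *\<^sub>R v) + g x) / t\<^sup>2 - ?a\<bar> \<le> e / 2"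
      using second_difference_limit[OF g u e2, of v] by blast
    obtain d2 where d2: "d2 > 0" "\<And>t. 0 < t \<and> t < d2 \<Longrightarrow>
      \<bar>(g (x + t *\<^sub>R v + t *\<^sub>R u) - g (x + t *\<^sub>R v) - g (x + t *\<^sub>R u) + g x) / t\<^sup>2 - ?b\<bar> \<le> e / 2"
      using second_difference_limit[OF g v e2, of u] by blast
    obtain t where t: "0 < t" "t < min d1 d2"
      using d1(1) d2(1) dense[of 0 "min d1 d2"] by auto
    have eq: "g (x + t *\<^sub>R v + t *\<^sub>R u) - g (x + t *\<^sub>R v) - g (x + t *\<^sub>R u) + g x
      = g (x + t *\<^sub>R u + t *\<^sub>R v) - g (x + t *\<^sub>R u) - g (x + t *\<^sub>R v) + g x"
      by (simp add: algebra_simps)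
    show ?thesis
      using d1(2)[of t] d2(2)[of t] t unfolding eq by linarith
  qed
  then have "\<bar>?a - ?b\<bar> \<le> 0" by (rule field_le_epsilon[of _ 0, simplified])
  then show ?thesis by simp
qed

text \<open>Symmetry of second derivatives only swaps the two outermost directions. When the heads
  differ, the induction hypothesis on each tail brings the other head to second place, and one swap
  joins the two lists.\<close>

lemma higher_deriv_perm:
  assumes d: "times_differentiable p f" and l: "length xs \<le> p" and m: "mset xs = mset ys"
  shows "higher_deriv f xs = higher_deriv f ys"
  using l m
proof (induction xs arbitrary: ys rule: length_induct)
  case (1 xs)
  note IH = 1(1)[rule_format] and l = 1(2) and m = 1(3)
  show ?case
  proof (cases xs)
    case Nil then show ?thesis using m by simp
  next
    case (Cons a as)
    have swap: "higher_deriv f (h # k # zs) = higher_deriv f (k # h # zs)" if "length zs + 2 \<le> p" for h k zs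
    proof
      fix x
      have g: "\<And>hs x. length hs < p \<Longrightarrow> higher_deriv f hs differentiable (at x)"
        using d by (simp add: times_differentiable_def)
      show "higher_deriv f (h # k # zs) x = higher_deriv f (k # h # zs) x"
        using symmetric_second_derivative[of "higher_deriv f zs" k x h] g[of zs] g[of "k # zs" x] g[of "h # zs" x] that
        by simp
    qed
    obtain b bs where ys: "ys = b # bs" using m Cons by (cases ys) auto
    have len: "length ys = length xs" using m by (metis mset_eq_length)
    show ?thesis
    proof (cases "a = b")
      case True
      then have "mset as = mset bs" using m Cons ys by simp
      then have "higher_deriv f as = higher_deriv f bs"
        using IH[of as bs] l Cons by simp
      then show ?thesis using Cons ys True by simp
    next
      case False
      then have "b \<in># mset as" using m Cons ys
        by (metis insert_noteq_member mset.simps(2))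
      then obtain cs where cs: "mset as = mset (b # cs)"
        by (metis ex_mset insert_DiffM mset.simps(2))
      then have lc: "length as = Suc (length cs)" by (metis length_Cons mset_eq_length)
      have "mset bs = mset (a # cs)"
        using m Cons ys cs by (simp add: add_mset_commute)
      then have h2: "higher_deriv f bs = higher_deriv f (a # cs)"
        using IH[of bs "a # cs"] l len ys by simp
      have h1: "higher_deriv f as = higher_deriv f (b # cs)"
        using IH[of as "b # cs"] l Cons cs by simp
      have "higher_deriv f (a # b # cs) = higher_deriv f (b # a # cs)"
        using l Cons lc by (intro swap) simp
      then show ?thesis using Cons ys h1 h2 by simp
    qed
  qed
qed

section \<open>Symmetric multilinear forms\<close>

text \<open>Linearity is asked of the head only, as invariance under permutation carries it to every
  slot. Lists of length other than \<open>k\<close> are unconstrained.\<close>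

definition sym_multilinear :: "nat \<Rightarrow> ('a::real_vector list \<Rightarrow> real) \<Rightarrow> bool" where
  "sym_multilinear k P \<longleftrightarrow> (\<forall>hs. Suc (length hs) = k \<longrightarrow> linear (\<lambda>h. P (h # hs)))
     \<and> (\<forall>xs ys. length xs = k \<longrightarrow> mset xs = mset ys \<longrightarrow> P xs = P ys)"

lemma sym_multilinear_linear:
  "sym_multilinear k P \<Longrightarrow> Suc (length hs) = k \<Longrightarrow> linear (\<lambda>h. P (h # hs))"
  by (simp add: sym_multilinear_def)

lemma sym_multilinear_perm:
  "sym_multilinear k P \<Longrightarrow> length xs = k \<Longrightarrow> mset xs = mset ys \<Longrightarrow> P xs = P ys"
  by (auto simp: sym_multilinear_def)

lemma sym_multilinear_Cons:
  assumes "sym_multilinear (Suc k) P"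
  shows "sym_multilinear k (\<lambda>hs. P (a # hs))"
  unfolding sym_multilinear_def
proof (intro conjI allI impI)
  fix hs :: "'a list" assume l: "Suc (length hs) = k"
  have "P (a # h # hs) = P (h # a # hs)" for h
    using l by (intro sym_multilinear_perm[OF assms]) auto
  then show "linear (\<lambda>h. P (a # h # hs))"
    using sym_multilinear_linear[OF assms, of "a # hs"] l by simp
next
  fix xs ys :: "'a list" assume "length xs = k" "mset xs = mset ys"
  then show "P (a # xs) = P (a # ys)"
    by (intro sym_multilinear_perm[OF assms]) auto
qed

lemma sym_multilinear_diff:
  assumes "sym_multilinear k P" "sym_multilinear k Q"
  shows "sym_multilinear k (\<lambda>hs. P hs - Q hs)"
proof -
  have "P xs - Q xs = P ys - Q ys" if "length xs = k" "mset xs = mset ys" for xs ys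
    using sym_multilinear_perm[OF assms(1) that] sym_multilinear_perm[OF assms(2) that] by simp
  moreover have "linear (\<lambda>h. P (h # hs) - Q (h # hs))" if "Suc (length hs) = k" for hs
    by (rule linear_compose_sub[OF sym_multilinear_linear[OF assms(1) that]
          sym_multilinear_linear[OF assms(2) that]])
  ultimately show ?thesis unfolding sym_multilinear_def by blast
qed

lemma higher_deriv_sym_multilinear:
  assumes "times_differentiable p f" "k \<le> p"
  shows "sym_multilinear k (\<lambda>hs. higher_deriv f hs x)"
  unfolding sym_multilinear_def
proof (intro conjI allI impI)
  fix hs :: "'a list" assume "Suc (length hs) = k"
  then have "higher_deriv f hs differentiable (at x)"
    using assms by (simp add: times_differentiable_def)
  then show "linear (\<lambda>h. higher_deriv f (h # hs) x)"
    using linear_frechet_derivative by simp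
next
  fix xs ys :: "'a list" assume "length xs = k" "mset xs = mset ys"
  then show "higher_deriv f xs x = higher_deriv f ys x"
    using higher_deriv_perm[OF assms(1), of xs ys] assms(2) by simp
qed

lemma sym_multilinear_scale:
  assumes "sym_multilinear p P" "j + length rest = p"
  shows "P (replicate j (c *\<^sub>R h) @ rest) = c ^ j * P (replicate j h @ rest)"
  using assms(2)
proof (induction j arbitrary: rest)
  case 0 then show ?case by simp
next
  case (Suc j)
  have "P (replicate (Suc j) (c *\<^sub>R h) @ rest) = c * P (h # replicate j (c *\<^sub>R h) @ rest)"
    using linear_scale[OF sym_multilinear_linear[OF assms(1), of "replicate j (c *\<^sub>R h) @ rest"], of c h] Suc.prems
    by simp
  also have "P (h # replicate j (c *\<^sub>R h) @ rest) = P (replicate j (c *\<^sub>R h) @ h # rest)"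
    using Suc.prems by (intro sym_multilinear_perm[OF assms(1)]) auto
  also have "\<dots> = c ^ j * P (replicate j h @ h # rest)"
    using Suc.prems by (intro Suc.IH) simp
  also have "P (replicate j h @ h # rest) = P (replicate (Suc j) h @ rest)"
    using Suc.prems by (intro sym_multilinear_perm[OF assms(1)]) auto
  finally show ?case by simp
qed

text \<open>Linearity in one copy of \<open>z + h\<close> parks either \<open>z\<close> or
  \<open>h\<close> in \<open>rest\<close>; Pascal's rule merges the two resulting sums.\<close>

lemma sym_multilinear_binomial:
  assumes P: "sym_multilinear p P" and l: "j + length rest = p"
  shows "P (replicate j (z + h) @ rest)
    = (\<Sum>i\<le>j. real (j choose i) * P (replicate (j - i) z @ replicate i h @ rest))"
  using l
proof (induction j arbitrary: rest)
  case 0 then show ?case by simp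
next
  case (Suc j)
  define R where "R i = P (replicate (Suc j - i) z @ replicate i h @ rest)" for i
  have "P (replicate (Suc j) (z + h) @ rest)
      = P (z # replicate j (z + h) @ rest) + P (h # replicate j (z + h) @ rest)"
    using linear_add[OF sym_multilinear_linear[OF P, of "replicate j (z + h) @ rest"], of z h] Suc.prems
    by simp
  also have "P (z # replicate j (z + h) @ rest) = P (replicate j (z + h) @ z # rest)"
    using Suc.prems by (intro sym_multilinear_perm[OF P]) auto
  also have "\<dots> = (\<Sum>i\<le>j. real (j choose i) * P (replicate (j - i) z @ replicate i h @ z # rest))"
    using Suc.prems by (intro Suc.IH) simp
  also have "\<dots> = (\<Sum>i\<le>j. real (j choose i) * R i)"
  proof (intro sum.cong refl)
    fix i assume "i \<in> {..j}"
    then show "real (j choose i) * P (replicate (j - i) z @ replicate i h @ z # rest) = real (j choose i) * R i"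
      unfolding R_def using Suc.prems
      by (intro arg_cong[where f="\<lambda>x. _ * x"] sym_multilinear_perm[OF P]) (auto simp: Suc_diff_le)
  qed
  also have "P (h # replicate j (z + h) @ rest) = P (replicate j (z + h) @ h # rest)"
    using Suc.prems by (intro sym_multilinear_perm[OF P]) auto
  also have "\<dots> = (\<Sum>i\<le>j. real (j choose i) * P (replicate (j - i) z @ replicate i h @ h # rest))"
    using Suc.prems by (intro Suc.IH) simp
  also have "\<dots> = (\<Sum>i\<le>j. real (j choose i) * R (Suc i))"
  proof (intro sum.cong refl)
    fix i assume "i \<in> {..j}"
    then show "real (j choose i) * P (replicate (j - i) z @ replicate i h @ h # rest) = real (j choose i) * R (Suc i)"
      unfolding R_def using Suc.prems
      by (intro arg_cong[where f="\<lambda>x. _ * x"] sym_multilinear_perm[OF P]) auto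
  qed
  also have "(\<Sum>i\<le>j. real (j choose i) * R i) + (\<Sum>i\<le>j. real (j choose i) * R (Suc i))
     = (\<Sum>i\<le>Suc j. real (Suc j choose i) * R i)"
  proof -
    have "(\<Sum>i\<le>Suc j. real (Suc j choose i) * R i) = R 0 + (\<Sum>i\<le>j. real (Suc j choose Suc i) * R (Suc i))"
      by (subst sum.atMost_Suc_shift) simp
    also have "\<dots> = R 0 + (\<Sum>i\<le>j. real (j choose Suc i) * R (Suc i)) + (\<Sum>i\<le>j. real (j choose i) * R (Suc i))"
      by (simp add: distrib_right sum.distrib)
    also have "R 0 + (\<Sum>i\<le>j. real (j choose Suc i) * R (Suc i)) = (\<Sum>i\<le>Suc j. real (j choose i) * R i)"
      by (subst sum.atMost_Suc_shift) simp
    finally show ?thesis by simp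
  qed
  finally show ?case by (simp add: R_def)
qed

section \<open>Polarization\<close>

text \<open>Iterated central differences: a signed sum of \<open>Q\<close> over the points z +/- h1
  +/- h2 and so on. These \<open>2 ^ length hs\<close> terms are later balanced by the factor
  \<open>2 ^ p\<close> in the polarization identity, so that only \<open>p ^ p / p!\<close> is
  lost.\<close>

fun iter_diff :: "'a::real_vector list \<Rightarrow> ('a \<Rightarrow> real) \<Rightarrow> 'a \<Rightarrow> real" where
  "iter_diff [] Q z = Q z"
| "iter_diff (h # hs) Q z = iter_diff hs (\<lambda>z. Q (z + h) - Q (z - h)) z"

lemma iter_diff_sum:
  "iter_diff hs (\<lambda>z. \<Sum>i\<in>I. c i * Q i z) z = (\<Sum>i\<in>I. c i * iter_diff hs (Q i) z)"
proof (induction hs arbitrary: Q)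
  case (Cons h hs)
  have "(\<lambda>z. (\<Sum>i\<in>I. c i * Q i (z + h)) - (\<Sum>i\<in>I. c i * Q i (z - h)))
      = (\<lambda>z. \<Sum>i\<in>I. c i * (Q i (z + h) - Q i (z - h)))"
    by (simp add: sum_subtractf right_diff_distrib)
  then show ?case using Cons.IH[of "\<lambda>i z. Q i (z + h) - Q i (z - h)"] by simp
qed simp

text \<open>Expand one difference in powers of \<open>h\<close>. The constant term cancels, and a
  term of order at least 2 leaves a degree in \<open>z\<close> below the number of remaining
  differences, which kill it. The linear term survives with factor \<open>2 * j\<close>.\<close>

lemma polarization:
  assumes P: "sym_multilinear p P" and l: "j + length rest = p" "j \<le> length hs"
  shows "iter_diff hs (\<lambda>z. P (replicate j z @ rest)) z
    = (if j = length hs then 2 ^ j * fact j * P (hs @ rest) else 0)"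
  using l
proof (induction hs arbitrary: j rest)
  case Nil then show ?case by simp
next
  case (Cons h hs)
  define Q where "Q i z = P (replicate (j - i) z @ replicate i h @ rest)" for i z
  define c :: "nat \<Rightarrow> real" where "c i = real (j choose i) * (1 - (- 1) ^ i)" for i
  have "P (replicate j (z + h) @ rest) - P (replicate j (z - h) @ rest) = (\<Sum>i\<le>j. c i * Q i z)" for z
  proof -
    have "P (replicate j (z - h) @ rest) = P (replicate j (z + (- 1) *\<^sub>R h) @ rest)" by simp
    also have "\<dots> = (\<Sum>i\<le>j. real (j choose i) * P (replicate (j - i) z @ replicate i ((- 1) *\<^sub>R h) @ rest))"
      by (rule sym_multilinear_binomial[OF P Cons.prems(1)])
    also have "\<dots> = (\<Sum>i\<le>j. real (j choose i) * ((- 1) ^ i * Q i z))"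
    proof (intro sum.cong refl)
      fix i assume i: "i \<in> {..j}"
      have "P (replicate (j - i) z @ replicate i ((- 1) *\<^sub>R h) @ rest)
          = P (replicate i ((- 1) *\<^sub>R h) @ replicate (j - i) z @ rest)"
        using Cons.prems i by (intro sym_multilinear_perm[OF P]) auto
      also have "\<dots> = (- 1) ^ i * P (replicate i h @ replicate (j - i) z @ rest)"
        using Cons.prems i by (intro sym_multilinear_scale[OF P]) auto
      also have "P (replicate i h @ replicate (j - i) z @ rest) = Q i z"
        unfolding Q_def using Cons.prems i by (intro sym_multilinear_perm[OF P]) auto
      finally show "real (j choose i) * P (replicate (j - i) z @ replicate i ((- 1) *\<^sub>R h) @ rest)
          = real (j choose i) * ((- 1) ^ i * Q i z)" by simp
    qed
    finally show ?thesis
      using sym_multilinear_binomial[OF P Cons.prems(1), of z h]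
      by (simp add: Q_def c_def sum_subtractf right_diff_distrib left_diff_distrib mult.assoc)
  qed
  then have "iter_diff (h # hs) (\<lambda>z. P (replicate j z @ rest)) z = (\<Sum>i\<le>j. c i * iter_diff hs (Q i) z)"
    by (simp add: iter_diff_sum)
  also have "\<dots> = (\<Sum>i\<le>j. if i = 1 then (if j = length (h # hs) then 2 ^ j * fact j * P (h # hs @ rest) else 0) else 0)"
  proof (intro sum.cong refl)
    fix i assume i: "i \<in> {..j}"
    show "c i * iter_diff hs (Q i) z = (if i = 1 then (if j = length (h # hs) then 2 ^ j * fact j * P (h # hs @ rest) else 0) else 0)"
    proof (cases "i = 0")
      case True then show ?thesis by (simp add: c_def)
    next
      case False
      have D: "iter_diff hs (Q i) z = (if j - i = length hs then 2 ^ (j - i) * fact (j - i) * P (hs @ replicate i h @ rest) else 0)"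
        unfolding Q_def using False i Cons.prems by (intro Cons.IH) auto
      show ?thesis
      proof (cases "i = 1")
        case True
        then obtain k where k: "j = Suc k" using i by (cases j) auto
        have "P (hs @ h # rest) = P (h # hs @ rest)" if "k = length hs"
          using that Cons.prems k by (intro sym_multilinear_perm[OF P]) auto
        then show ?thesis using D True k by (auto simp: c_def)
      next
        case F: False
        then have "j - i \<noteq> length hs" using False i Cons.prems by auto
        then show ?thesis using D F by simp
      qed
    qed
  qed
  also have "\<dots> = (if j = length (h # hs) then 2 ^ j * fact j * P (h # hs @ rest) else 0)"
    by (cases j) (auto simp: sum.delta)
  finally show ?case by simp
qed

text \<open>This is what makes the supremum in \<open>sym_form_norm\<close> an actual bound. The
  head is expanded in the basis, one slot per induction step.\<close>

lemma sym_multilinear_bounded: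
  fixes P :: "'a::euclidean_space list \<Rightarrow> real"
  assumes "sym_multilinear k P"
  shows "\<exists>K. \<forall>hs. length hs = k \<longrightarrow> (\<forall>h\<in>set hs. norm h \<le> r) \<longrightarrow> \<bar>P hs\<bar> \<le> K"
  using assms
proof (induction k arbitrary: P)
  case 0
  then show ?case by auto
next
  case (Suc k)
  have "\<exists>K. \<forall>hs. length hs = k \<longrightarrow> (\<forall>h\<in>set hs. norm h \<le> r) \<longrightarrow> \<bar>P (b # hs)\<bar> \<le> K" for b
    by (rule Suc.IH[OF sym_multilinear_Cons[OF Suc.prems]])
  then obtain K where K: "\<And>b hs. length hs = k \<Longrightarrow> (\<forall>h\<in>set hs. norm h \<le> r) \<Longrightarrow> \<bar>P (b # hs)\<bar> \<le> K b"
    by metis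
  show ?case
  proof (intro exI[of _ "\<Sum>b\<in>Basis. r * K b"] allI impI)
    fix hs :: "'a list" assume l: "length hs = Suc k" and n: "\<forall>h\<in>set hs. norm h \<le> r"
    then obtain h ks where hs: "hs = h # ks" by (cases hs) auto
    have lin: "linear (\<lambda>h. P (h # ks))"
      using sym_multilinear_linear[OF Suc.prems, of ks] l hs by simp
    have "P hs = (\<lambda>h. P (h # ks)) (\<Sum>b\<in>Basis. (h \<bullet> b) *\<^sub>R b)"
      by (simp add: euclidean_representation hs)
    also have "\<dots> = (\<Sum>b\<in>Basis. (h \<bullet> b) * P (b # ks))"
      by (simp only: linear_sum[OF lin] linear_scale[OF lin]) simp
    finally have "\<bar>P hs\<bar> \<le> (\<Sum>b\<in>Basis. \<bar>(h \<bullet> b) * P (b # ks)\<bar>)" by simp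
    also have "\<dots> \<le> (\<Sum>b\<in>Basis. r * K b)"
    proof (intro sum_mono)
      fix b :: 'a assume b: "b \<in> Basis"
      have 1: "\<bar>h \<bullet> b\<bar> \<le> r" using Basis_le_norm[OF b, of h] n hs by auto
      have 2: "\<bar>P (b # ks)\<bar> \<le> K b" using K[of ks b] l n hs by auto
      show "\<bar>(h \<bullet> b) * P (b # ks)\<bar> \<le> r * K b"
        using mult_mono[OF 1 2] 1 by (simp add: abs_mult)
    qed
    finally show "\<bar>P hs\<bar> \<le> (\<Sum>b\<in>Basis. r * K b)" .
  qed
qed

context pos_def_operator begin

text \<open>The offset \<open>a\<close> collects the norms of the directions already used; each
  difference doubles the prefactor.\<close>

lemma iter_diff_bound:
  assumes "\<And>z. \<bar>Q z\<bar> \<le> M * (\<parallel>z\<parallel> + a) ^ k" "a \<ge> 0" "M \<ge> 0"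
  shows "\<bar>iter_diff hs Q z\<bar> \<le> 2 ^ length hs * M * (\<parallel>z\<parallel> + a + sum_list (map (primal_norm B) hs)) ^ k"
  using assms
proof (induction hs arbitrary: Q M a)
  case Nil then show ?case by simp
next
  case (Cons h hs)
  have "\<bar>iter_diff hs (\<lambda>z. Q (z + h) - Q (z - h)) z\<bar>
    \<le> 2 ^ length hs * (2 * M) * (\<parallel>z\<parallel> + (\<parallel>h\<parallel> + a) + sum_list (map (primal_norm B) hs)) ^ k"
  proof (rule Cons.IH)
    fix z
    have "M * (\<parallel>z + h\<parallel> + a) ^ k \<le> M * (\<parallel>z\<parallel> + (\<parallel>h\<parallel> + a)) ^ k"
      using Cons.prems nrm_triangle[of z h] by (intro mult_left_mono power_mono) auto
    moreover have "M * (\<parallel>z - h\<parallel> + a) ^ k \<le> M * (\<parallel>z\<parallel> + (\<parallel>h\<parallel> + a)) ^ k"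
      using Cons.prems nrm_triangle[of z "- h"] by (intro mult_left_mono power_mono) (auto simp: nrm_minus)
    ultimately show "\<bar>Q (z + h) - Q (z - h)\<bar> \<le> 2 * M * (\<parallel>z\<parallel> + (\<parallel>h\<parallel> + a)) ^ k"
      using Cons.prems(1)[of "z + h"] Cons.prems(1)[of "z - h"] by linarith
  qed (use Cons.prems in auto)
  then show ?case by (simp add: add_ac mult_ac)
qed

lemma sym_form_norm_bound:
  assumes P: "sym_multilinear k P"
  shows "\<bar>P (replicate k h)\<bar> \<le> sym_form_norm B k P * \<parallel>h\<parallel> ^ k" "sym_form_norm B k P \<ge> 0"
proof -
  obtain c where c: "c > 0" "\<And>x. norm x \<le> c * \<parallel>x\<parallel>" using norm_le_nrm by blast
  obtain K where K: "\<And>hs. length hs = k \<Longrightarrow> (\<forall>h\<in>set hs. norm h \<le> c) \<Longrightarrow> \<bar>P hs\<bar> \<le> K"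
    using sym_multilinear_bounded[OF P, of c] by blast
  have "\<bar>P (replicate k h)\<bar> \<le> K" if "\<parallel>h\<parallel> \<le> 1" for h
  proof (rule K)
    have "c * \<parallel>h\<parallel> \<le> c * 1" using that c(1) by (intro mult_left_mono) auto
    then have "norm h \<le> c" using c(2)[of h] by linarith
    then show "\<forall>h\<in>set (replicate k h). norm h \<le> c" by simp
  qed simp
  then have bdd: "bdd_above {\<bar>P (replicate k h)\<bar> |h. \<parallel>h\<parallel> \<le> 1}"
    by (auto intro!: bdd_aboveI[of _ K])
  have unit: "\<bar>P (replicate k h)\<bar> \<le> sym_form_norm B k P" if "\<parallel>h\<parallel> \<le> 1" for h
    unfolding sym_form_norm_def using bdd that by (intro cSup_upper) auto
  show nn: "sym_form_norm B k P \<ge> 0"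
    using unit[of 0] by simp
  show "\<bar>P (replicate k h)\<bar> \<le> sym_form_norm B k P * \<parallel>h\<parallel> ^ k"
  proof (cases "h = 0")
    case True
    show ?thesis
    proof (cases k)
      case 0 then show ?thesis using unit[of 0] by simp
    next
      case (Suc j)
      then have "P (replicate k h) = 0"
        using linear_0[OF sym_multilinear_linear[OF P, of "replicate j 0"]] True by simp
      then show ?thesis using nn by simp
    qed
  next
    case False
    define e where "e = (1 / \<parallel>h\<parallel>) *\<^sub>R h"
    have p: "\<parallel>h\<parallel> > 0" using False by (simp add: nrm_pos_iff)
    have e: "\<parallel>e\<parallel> = 1" "h = \<parallel>h\<parallel> *\<^sub>R e" using p by (auto simp: e_def nrm_scale)
    have "P (replicate k (\<parallel>h\<parallel> *\<^sub>R e) @ []) = \<parallel>h\<parallel> ^ k * P (replicate k e @ [])"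
      by (rule sym_multilinear_scale[OF P]) simp
    then have "P (replicate k h) = \<parallel>h\<parallel> ^ k * P (replicate k e)" using e(2) by simp
    then have "\<bar>P (replicate k h)\<bar> = \<parallel>h\<parallel> ^ k * \<bar>P (replicate k e)\<bar>" by (simp add: abs_mult)
    also have "\<dots> \<le> \<parallel>h\<parallel> ^ k * sym_form_norm B k P"
      using unit[of e] e by (intro mult_left_mono) auto
    finally show ?thesis by (simp add: mult.commute)
  qed
qed

text \<open>From \<open>z = 0\<close>, the evaluation points of the signed sum stay within distance
  \<open>p\<close> of the origin, being signed sums of \<open>p\<close> vectors of norm at most
  1.\<close>

lemma polarization_bound:
  assumes P: "sym_multilinear p P" and M: "\<And>h. \<bar>P (replicate p h)\<bar> \<le> M * \<parallel>h\<parallel> ^ p" "M \<ge> 0"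
    and l: "length hs = p" and u: "\<And>h. h \<in> set hs \<Longrightarrow> \<parallel>h\<parallel> \<le> 1"
  shows "\<bar>P hs\<bar> \<le> real p ^ p / fact p * M"
proof -
  have s: "sum_list (map (primal_norm B) hs) \<le> real (length hs)"
    using u by (induction hs) (auto intro!: add_mono simp: add.commute)
  have s0: "sum_list (map (primal_norm B) hs) \<ge> 0"
    by (intro sum_list_nonneg) auto
  have "2 ^ p * fact p * P hs = iter_diff hs (\<lambda>z. P (replicate p z)) 0"
    using polarization[OF P, of p "[]" hs 0] l by simp
  then have "2 ^ p * fact p * \<bar>P hs\<bar> = \<bar>iter_diff hs (\<lambda>z. P (replicate p z)) 0\<bar>"
    by (metis abs_mult abs_of_nonneg fact_ge_zero mult_nonneg_nonneg zero_le_numeral zero_le_power)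
  also have "\<dots> \<le> 2 ^ length hs * M * (\<parallel>0\<parallel> + 0 + sum_list (map (primal_norm B) hs)) ^ p"
    using M by (intro iter_diff_bound) auto
  also have "\<dots> \<le> 2 ^ p * M * real p ^ p"
    using s s0 l M by (auto intro!: mult_left_mono power_mono)
  finally have "2 ^ p * (fact p * \<bar>P hs\<bar>) \<le> 2 ^ p * (M * real p ^ p)" by (simp add: mult_ac)
  then have "fact p * \<bar>P hs\<bar> \<le> M * real p ^ p" by simp
  then show ?thesis by (simp add: field_simps)
qed

lemma mixed_form_bound:
  assumes P: "sym_multilinear (Suc k) P"
    and M: "\<And>h. \<bar>P (replicate (Suc k) h)\<bar> \<le> M * \<parallel>h\<parallel> ^ Suc k" "M \<ge> 0"
  shows "\<bar>P (v # replicate k h)\<bar> \<le> real (Suc k) ^ Suc k / fact (Suc k) * M * \<parallel>h\<parallel> ^ k * \<parallel>v\<parallel>"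
proof -
  obtain e where e: "\<parallel>e\<parallel> \<le> 1" "h = \<parallel>h\<parallel> *\<^sub>R e"
  proof (cases "h = 0")
    case True then show ?thesis using that[of 0] by simp
  next
    case False
    then show ?thesis using that[of "(1 / \<parallel>h\<parallel>) *\<^sub>R h"] by (simp add: nrm_scale)
  qed
  obtain w where w: "\<parallel>w\<parallel> \<le> 1" "v = \<parallel>v\<parallel> *\<^sub>R w"
  proof (cases "v = 0")
    case True then show ?thesis using that[of 0] by simp
  next
    case False
    then show ?thesis using that[of "(1 / \<parallel>v\<parallel>) *\<^sub>R v"] by (simp add: nrm_scale)
  qed
  have "P (v # replicate k h) = P (\<parallel>v\<parallel> *\<^sub>R w # replicate k h)" using w by simp
  also have "\<dots> = \<parallel>v\<parallel> * P (w # replicate k h)"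
    using linear_scale[OF sym_multilinear_linear[OF P, of "replicate k h"]] by simp
  also have "P (w # replicate k h) = P (replicate k (\<parallel>h\<parallel> *\<^sub>R e) @ [w])"
    using e by (intro sym_multilinear_perm[OF P]) auto
  also have "\<dots> = \<parallel>h\<parallel> ^ k * P (replicate k e @ [w])"
    by (rule sym_multilinear_scale[OF P]) simp
  finally have "\<bar>P (v # replicate k h)\<bar> = \<parallel>v\<parallel> * \<parallel>h\<parallel> ^ k * \<bar>P (replicate k e @ [w])\<bar>"
    by (simp add: abs_mult)
  also have "\<dots> \<le> \<parallel>v\<parallel> * \<parallel>h\<parallel> ^ k * (real (Suc k) ^ Suc k / fact (Suc k) * M)"
    using e w by (intro mult_left_mono polarization_bound[OF P M]) auto
  finally show ?thesis by (simp only: mult_ac)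
qed

end

section \<open>Taylor expansion and the regularized model\<close>

lemma grad_apply:
  assumes "f differentiable (at x)"
  shows "blinfun_apply (grad f x) = frechet_derivative f (at x)"
  unfolding grad_def using assms
  by (intro bounded_linear_Blinfun_apply has_derivative_bounded_linear) (simp add: frechet_derivative_works)

text \<open>Expanding one slot in the basis writes the form as a sum of coordinates times forms with
  one more frozen slot, so the product rule and the induction hypothesis apply.\<close>

lemma sym_multilinear_has_derivative:
  fixes P :: "'a::euclidean_space list \<Rightarrow> real"
  assumes P: "sym_multilinear k P" and l: "j + length rest = k"
  shows "((\<lambda>z. P (replicate j z @ rest)) has_derivative
    (\<lambda>v. real j * P (v # replicate (j - 1) z @ rest))) (at z)"
  using l
proof (induction j arbitrary: rest)
  case 0 then show ?case by simp
next
  case (Suc j)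
  have expand: "P (u # bs) = (\<Sum>b\<in>Basis. (u \<bullet> b) * P (b # bs))" if "Suc (length bs) = k" for u bs
  proof -
    have lin: "linear (\<lambda>h. P (h # bs))" by (rule sym_multilinear_linear[OF P that])
    have "P (u # bs) = (\<lambda>h. P (h # bs)) (\<Sum>b\<in>Basis. (u \<bullet> b) *\<^sub>R b)"
      by (simp add: euclidean_representation)
    also have "\<dots> = (\<Sum>b\<in>Basis. (u \<bullet> b) * P (b # bs))"
      by (simp only: linear_sum[OF lin] linear_scale[OF lin]) simp
    finally show ?thesis .
  qed
  have eq: "P (replicate (Suc j) z @ rest) = (\<Sum>b\<in>Basis. (z \<bullet> b) * P (replicate j z @ b # rest))" for z
  proof -
    have "P (replicate (Suc j) z @ rest) = (\<Sum>b\<in>Basis. (z \<bullet> b) * P (b # replicate j z @ rest))"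
      using expand[of "replicate j z @ rest" z] Suc.prems by simp
    also have "\<dots> = (\<Sum>b\<in>Basis. (z \<bullet> b) * P (replicate j z @ b # rest))"
      using Suc.prems by (intro sum.cong refl arg_cong[where f="\<lambda>x. _ * x"] sym_multilinear_perm[OF P]) auto
    finally show ?thesis .
  qed
  have "((\<lambda>z. \<Sum>b\<in>Basis. (z \<bullet> b) * P (replicate j z @ b # rest)) has_derivative
      (\<lambda>v. \<Sum>b\<in>Basis. (z \<bullet> b) * (real j * P (v # replicate (j - 1) z @ b # rest)) + (v \<bullet> b) * P (replicate j z @ b # rest))) (at z)"
    using Suc.prems by (intro has_derivative_sum has_derivative_mult Suc.IH
        bounded_linear.has_derivative[OF bounded_linear_inner_left] has_derivative_ident) auto
  moreover have "(\<Sum>b\<in>Basis. (z \<bullet> b) * (real j * P (v # replicate (j - 1) z @ b # rest)) + (v \<bullet> b) * P (replicate j z @ b # rest))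
      = real (Suc j) * P (v # replicate (Suc j - 1) z @ rest)" for v
  proof -
    have 1: "(\<Sum>b\<in>Basis. (v \<bullet> b) * P (replicate j z @ b # rest)) = P (v # replicate j z @ rest)"
    proof -
      have "(\<Sum>b\<in>Basis. (v \<bullet> b) * P (replicate j z @ b # rest)) = (\<Sum>b\<in>Basis. (v \<bullet> b) * P (b # replicate j z @ rest))"
        using Suc.prems by (intro sum.cong refl arg_cong[where f="\<lambda>x. _ * x"] sym_multilinear_perm[OF P]) auto
      then show ?thesis using expand[of "replicate j z @ rest" v] Suc.prems by simp
    qed
    have 2: "(\<Sum>b\<in>Basis. (z \<bullet> b) * (real j * P (v # replicate (j - 1) z @ b # rest))) = real j * P (v # replicate j z @ rest)"
    proof (cases j)
      case 0 then show ?thesis by simp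
    next
      case (Suc i)
      have "(\<Sum>b\<in>Basis. (z \<bullet> b) * (real j * P (v # replicate (j - 1) z @ b # rest)))
        = real j * (\<Sum>b\<in>Basis. (z \<bullet> b) * P (b # v # replicate (j - 1) z @ rest))"
        unfolding sum_distrib_left mult.left_commute[of "real j"] using Suc.prems Suc
        by (intro sum.cong refl arg_cong[where f="\<lambda>x. _ * x"] sym_multilinear_perm[OF P]) auto
      also have "\<dots> = real j * P (z # v # replicate (j - 1) z @ rest)"
        using expand[of "v # replicate (j - 1) z @ rest" z] Suc.prems Suc by simp
      also have "P (z # v # replicate (j - 1) z @ rest) = P (v # replicate j z @ rest)"
        using Suc.prems Suc by (intro sym_multilinear_perm[OF P]) auto
      finally show ?thesis .
    qed
    show ?thesis unfolding sum.distrib 1 2 by (simp add: algebra_simps)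
  qed
  ultimately show ?case by (simp only: eq)
qed

lemma taylor_has_derivative:
  fixes f :: "'a::euclidean_space \<Rightarrow> real"
  assumes td: "times_differentiable p f"
  shows "(taylor f p x has_derivative
    (\<lambda>v. \<Sum>k<p. higher_deriv f (v # replicate k (y - x)) x / fact k)) (at y)"
proof -
  have shift: "((\<lambda>y. y - x) has_derivative (\<lambda>v. v)) (at y)"
    by (auto intro!: derivative_eq_intros)
  have "((\<lambda>y. higher_deriv f (replicate i (y - x)) x) has_derivative
      (\<lambda>v. real i * higher_deriv f (v # replicate (i - 1) (y - x)) x)) (at y)" if "i \<le> p" for i
    using has_derivative_compose[OF shift sym_multilinear_has_derivative
        [OF higher_deriv_sym_multilinear[OF td that], of i "[]"]] by simp
  then have "((\<lambda>y. f x + (\<Sum>i=1..p. 1 / fact i * higher_deriv f (replicate i (y - x)) x)) has_derivative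
      (\<lambda>v. 0 + (\<Sum>i=1..p. 1 / fact i * (real i * higher_deriv f (v # replicate (i - 1) (y - x)) x)))) (at y)"
    by (intro has_derivative_add has_derivative_const has_derivative_sum has_derivative_mult_right) auto
  moreover have "(\<Sum>i=1..p. 1 / fact i * (real i * higher_deriv f (v # replicate (i - 1) (y - x)) x))
      = (\<Sum>k<p. higher_deriv f (v # replicate k (y - x)) x / fact k)" for v
    by (rule sum.reindex_bij_witness[of _ Suc "\<lambda>i. i - 1"])
      (auto simp: fact_num_eq_if field_simps)
  ultimately show ?thesis unfolding taylor_def[abs_def] by simp
qed

text \<open>The list \<open>L\<close> of fixed inner directions serves both uses: \<open>[]\<close>
  expands the function, \<open>[v]\<close> its derivative along \<open>v\<close>. The Lagrange point
  may depend on \<open>v\<close>, which is harmless because the estimates are made for one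
  \<open>v\<close> at a time.\<close>

lemma taylor_line:
  fixes f :: "'a::euclidean_space \<Rightarrow> real"
  assumes td: "times_differentiable p f" and k: "k + length L \<le> p" "k \<ge> 1"
  shows "\<exists>t. 0 < t \<and> t < 1 \<and> higher_deriv f L (x + h)
    = (\<Sum>m<k. higher_deriv f (replicate m h @ L) x / fact m) + higher_deriv f (replicate k h @ L) (x + t *\<^sub>R h) / fact k"
proof -
  define F where "F m t = higher_deriv f (replicate m h @ L) (x + t *\<^sub>R h)" for m t
  have "\<exists>t::real. 0 < t \<and> t < 1 \<and> F 0 1 = (\<Sum>m<k. (F m 0 / fact m) * 1 ^ m) + (F k t / fact k) * 1 ^ k"
  proof (rule Maclaurin)
    show "\<forall>m t. m < k \<and> 0 \<le> t \<and> t \<le> 1 \<longrightarrow> (F m has_real_derivative F (Suc m) t) (at t)"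
    proof (intro allI impI)
      fix m t assume "m < k \<and> (0::real) \<le> t \<and> t \<le> 1"
      then have "higher_deriv f (replicate m h @ L) differentiable (at (x + t *\<^sub>R h))"
        using td k unfolding times_differentiable_def by simp
      from line_has_derivative[OF this] show "(F m has_real_derivative F (Suc m) t) (at t)"
        by (simp add: F_def[abs_def])
    qed
  qed (use k in auto)
  then show ?thesis by (simp add: F_def)
qed

context pos_def_operator begin

text \<open>Away from 0 this is the chain rule for a power of the quadratic form. At 0 that power
  need not be differentiable as an outer function, but for \<open>q \<ge> 2\<close> the whole
  expression is dominated by a square.\<close>

lemma nrm_powr_has_derivative:
  assumes q: "q \<ge> 2"
  shows "((\<lambda>h. \<parallel>h\<parallel> powr q) has_derivative (\<lambda>v. q * \<parallel>h\<parallel> powr (q - 2) * \<langle>h,v\<rangle>)) (at h)"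
proof (cases "h = 0")
  case True
  obtain c where c: "c > 0" "\<And>x. \<parallel>x\<parallel> \<le> c * norm x" using nrm_le_norm by blast
  have "((\<lambda>h. \<parallel>h\<parallel> powr q) has_derivative (\<lambda>v. 0)) (at 0)"
    unfolding has_derivative_at_alt
  proof (intro conjI allI impI)
    fix e :: real assume e: "e > 0"
    show "\<exists>d>0. \<forall>y. norm (y - 0) < d \<longrightarrow> norm (\<parallel>y\<parallel> powr q - \<parallel>0\<parallel> powr q - 0) \<le> e * norm (y - 0)"
    proof (intro exI[of _ "min (1 / c) (e / c\<^sup>2)"] conjI allI impI)
      show "min (1 / c) (e / c\<^sup>2) > 0" using c e by simp
      fix y :: 'a assume y: "norm (y - 0) < min (1 / c) (e / c\<^sup>2)"
      \<comment> \<open>The first bound lets the exponent \<open>q\<close> drop to 2; the second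
        trades one factor of the resulting square for \<open>e\<close>.\<close>
      then have 1: "c * norm y \<le> 1" "c\<^sup>2 * norm y \<le> e" using c by (auto simp: field_simps)
      then have y1: "\<parallel>y\<parallel> \<le> 1" using c(2)[of y] by linarith
      have "\<parallel>y\<parallel> powr q \<le> \<parallel>y\<parallel> powr 2"
        using q y1 by (intro powr_mono') auto
      also have "\<dots> = \<parallel>y\<parallel>\<^sup>2" by (cases "y = 0") (auto simp: powr_numeral)
      also have "\<dots> \<le> (c * norm y)\<^sup>2" using c(2)[of y] by (intro power_mono) auto
      also have "\<dots> = (c\<^sup>2 * norm y) * norm y" by (simp add: power2_eq_square mult_ac)
      also have "\<dots> \<le> e * norm y" using 1 by (intro mult_right_mono) auto
      finally show "norm (\<parallel>y\<parallel> powr q - \<parallel>0\<parallel> powr q - 0) \<le> e * norm (y - 0)" by simp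
    qed
  qed simp
  then show ?thesis using True by (simp add: bil_simps)
next
  case False
  have hp: "\<langle>h,h\<rangle> > 0" using pos False by simp
  have eq: "\<parallel>u\<parallel> powr s = \<langle>u,u\<rangle> powr (s / 2)" for u s
    by (simp add: primal_norm_def powr_half_sqrt[symmetric] bil_nonneg powr_powr)
  have "((\<lambda>u. \<langle>u,u\<rangle>) has_derivative (\<lambda>v. \<langle>h,v\<rangle> + \<langle>v,h\<rangle>)) (at h)"
    by (rule bounded_bilinear.FDERIV[OF bounded_bilinear_bil has_derivative_ident has_derivative_ident])
  moreover have "((\<lambda>s. s powr (q / 2)) has_derivative (*) (q / 2 * \<langle>h,h\<rangle> powr (q / 2 - 1))) (at \<langle>h,h\<rangle>)"
    using has_real_derivative_powr[OF hp, of "q / 2"] by (simp add: has_field_derivative_def)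
  ultimately have "((\<lambda>u. \<langle>u,u\<rangle> powr (q / 2)) has_derivative
      (\<lambda>v. q / 2 * \<langle>h,h\<rangle> powr (q / 2 - 1) * (\<langle>h,v\<rangle> + \<langle>v,h\<rangle>))) (at h)"
    by (rule has_derivative_compose)
  moreover have "(\<lambda>v. q / 2 * \<langle>h,h\<rangle> powr (q / 2 - 1) * (\<langle>h,v\<rangle> + \<langle>v,h\<rangle>)) = (\<lambda>v. q * \<langle>h,h\<rangle> powr ((q - 2) / 2) * \<langle>h,v\<rangle>)"
  proof
    fix v
    show "q / 2 * \<langle>h,h\<rangle> powr (q / 2 - 1) * (\<langle>h,v\<rangle> + \<langle>v,h\<rangle>) = q * \<langle>h,h\<rangle> powr ((q - 2) / 2) * \<langle>h,v\<rangle>"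
      using sym[of v h] by (simp add: diff_divide_distrib)
  qed
  ultimately show ?thesis by (simp only: eq)
qed

end

section \<open>Taylor and gradient estimates under convexity and a Hoelder condition\<close>

locale holder_smooth = pos_def_operator B
  for B :: "'a::euclidean_space \<Rightarrow> ('a \<Rightarrow>\<^sub>L real)" +
  fixes f :: "'a \<Rightarrow> real" and p :: nat and \<nu> :: real
  assumes p2: "p \<ge> 2" and cvx: "convex_on UNIV f" and td: "times_differentiable p f"
    and nu0: "0 \<le> \<nu>" and nu1: "\<nu> \<le> 1" and fin: "holder_const B f p \<nu> < \<infinity>"
begin

definition "Hf = real_of_ereal (holder_const B f p \<nu>)"

lemma sym_multilinear_diff_deriv: "sym_multilinear p (\<lambda>hs. higher_deriv f hs x - higher_deriv f hs y)"
  by (intro sym_multilinear_diff higher_deriv_sym_multilinear[OF td]) auto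

text \<open>A single pair of distinct points already gives a nonnegative quotient. With finiteness
  from above, the extended real is finite and \<open>Hf\<close> represents it faithfully.\<close>

lemma holder_bound:
  assumes "x \<noteq> y"
  shows "sym_form_norm B p (\<lambda>hs. higher_deriv f hs x - higher_deriv f hs y) \<le> Hf * \<parallel>x - y\<parallel> powr \<nu>"
    and "Hf \<ge> 0"
proof -
  let ?s = "sym_form_norm B p (\<lambda>hs. higher_deriv f hs x - higher_deriv f hs y)"
  have s: "?s \<ge> 0" by (rule sym_form_norm_bound(2)[OF sym_multilinear_diff_deriv])
  have le: "ereal (?s / \<parallel>x - y\<parallel> powr \<nu>) \<le> holder_const B f p \<nu>"
    unfolding holder_const_def using assms by (intro Sup_upper) blast
  have "0 \<le> ereal (?s / \<parallel>x - y\<parallel> powr \<nu>)" using s by simp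
  then have h: "holder_const B f p \<nu> \<ge> 0" using le by order
  then have "holder_const B f p \<nu> = ereal Hf"
    using fin by (simp add: Hf_def ereal_real')
  then show "Hf \<ge> 0" using h by simp
  have "?s / \<parallel>x - y\<parallel> powr \<nu> \<le> Hf" using le \<open>_ = ereal Hf\<close> by simp
  moreover have "\<parallel>x - y\<parallel> powr \<nu> > 0" using assms by simp
  ultimately show "?s \<le> Hf * \<parallel>x - y\<parallel> powr \<nu>" by (simp add: field_simps)
qed

lemma Hf_nonneg: "Hf \<ge> 0"
proof -
  obtain b :: 'a where "b \<in> Basis" using nonempty_Basis by blast
  then have "b \<noteq> 0" using nonzero_Basis by blast
  then show ?thesis by (rule holder_bound(2))
qed

text \<open>Here \<open>x + t *\<^sub>R h\<close> is the Lagrange point. Bounding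
  \<open>t powr \<nu>\<close> by 1 is where an integral remainder would have given a sharper
  constant.\<close>

lemma diff_deriv_diag_bound:
  assumes t: "0 < t" "t < 1"
  shows "\<bar>higher_deriv f (replicate p u) (x + t *\<^sub>R h) - higher_deriv f (replicate p u) x\<bar>
    \<le> Hf * \<parallel>h\<parallel> powr \<nu> * \<parallel>u\<parallel> ^ p"
proof (cases "h = 0")
  case True then show ?thesis using Hf_nonneg by simp
next
  case False
  let ?P = "\<lambda>hs. higher_deriv f hs (x + t *\<^sub>R h) - higher_deriv f hs x"
  have "sym_form_norm B p ?P \<le> Hf * \<parallel>x + t *\<^sub>R h - x\<parallel> powr \<nu>"
    using False t by (intro holder_bound) auto
  also have "\<parallel>x + t *\<^sub>R h - x\<parallel> = t * \<parallel>h\<parallel>" using t by (simp add: nrm_scale)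
  also have "Hf * (t * \<parallel>h\<parallel>) powr \<nu> \<le> Hf * \<parallel>h\<parallel> powr \<nu>"
    using t nu0 Hf_nonneg by (intro mult_left_mono powr_mono2) (auto intro: mult_left_le_one_le)
  finally have "sym_form_norm B p ?P * \<parallel>u\<parallel> ^ p \<le> Hf * \<parallel>h\<parallel> powr \<nu> * \<parallel>u\<parallel> ^ p"
    by (intro mult_right_mono) auto
  then show ?thesis using sym_form_norm_bound(1)[OF sym_multilinear_diff_deriv, of u "x + t *\<^sub>R h" x] by linarith
qed

lemma powr_power_add: "\<parallel>h\<parallel> powr a * \<parallel>h\<parallel> ^ n = \<parallel>h\<parallel> powr (real n + a)" if "n > 0"
  using that by (cases "h = 0") (auto simp: powr_add powr_realpow nrm_pos_iff)

lemma taylor_error: "\<bar>f y - taylor f p x y\<bar> \<le> Hf / fact p * \<parallel>y - x\<parallel> powr (real p + \<nu>)"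
proof -
  define h where "h = y - x"
  obtain t where t: "0 < t" "t < 1" "higher_deriv f [] (x + h)
    = (\<Sum>m<p. higher_deriv f (replicate m h @ []) x / fact m) + higher_deriv f (replicate p h @ []) (x + t *\<^sub>R h) / fact p"
    using taylor_line[OF td, of p "[]" x h] p2 by auto
  have "taylor f p x y = (\<Sum>m\<in>{..p}. higher_deriv f (replicate m h) x / fact m)"
    unfolding taylor_def h_def[symmetric] atLeast0AtMost[symmetric]
    by (subst sum.atLeast_Suc_atMost[of 0 p]) simp_all
  also have "{..p} = insert p {..<p}" by auto
  finally have "f y - taylor f p x y = (higher_deriv f (replicate p h) (x + t *\<^sub>R h) - higher_deriv f (replicate p h) x) / fact p"
    using t(3) by (simp add: h_def diff_divide_distrib)
  then have "\<bar>f y - taylor f p x y\<bar> = \<bar>higher_deriv f (replicate p h) (x + t *\<^sub>R h) - higher_deriv f (replicate p h) x\<bar> / fact p"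
    by simp
  also have "\<dots> \<le> Hf * \<parallel>h\<parallel> powr \<nu> * \<parallel>h\<parallel> ^ p / fact p"
    using diff_deriv_diag_bound[OF t(1,2), of h x h] by (intro divide_right_mono) auto
  also have "\<dots> = Hf / fact p * \<parallel>h\<parallel> powr (real p + \<nu>)"
    using powr_power_add[of p h \<nu>] p2 by (simp add: mult.assoc)
  finally show ?thesis by (simp add: h_def)
qed

lemma f_differentiable: "f differentiable (at x)"
  using td p2 by (auto simp: times_differentiable_def dest!: spec[of _ "[]"])

text \<open>The remainder of order \<open>p - 1\<close> for the derivative along \<open>v\<close> is
  a mixed value, with \<open>p - 1\<close> slots equal to the step and one equal to
  \<open>v\<close>; hence the polarization constant \<open>p ^ p / p!\<close>.\<close>

lemma taylor_grad_error:
  "\<bar>blinfun_apply (grad f y) v - frechet_derivative (taylor f p x) (at y) v\<bar>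
    \<le> real p ^ p / fact p * (Hf / fact (p - 1)) * \<parallel>y - x\<parallel> powr (real p + \<nu> - 1) * \<parallel>v\<parallel>"
proof -
  define h where "h = y - x"
  define k where "k = p - 1"
  have pk: "p = Suc k" and k: "k \<ge> 1" using p2 by (auto simp: k_def)
  obtain t where t: "0 < t" "t < 1" "higher_deriv f [v] (x + h)
    = (\<Sum>m<k. higher_deriv f (replicate m h @ [v]) x / fact m) + higher_deriv f (replicate k h @ [v]) (x + t *\<^sub>R h) / fact k"
    using taylor_line[OF td, of k "[v]" x h] k pk by auto
  have perm: "higher_deriv f (replicate m h @ [v]) = higher_deriv f (v # replicate m h)" if "m \<le> k" for m
    using that pk by (intro higher_deriv_perm[OF td]) auto
  have "frechet_derivative (taylor f p x) (at y) v = (\<Sum>m<p. higher_deriv f (v # replicate m h) x / fact m)"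
    using fun_cong[OF frechet_derivative_at[OF taylor_has_derivative[OF td, of x y]], of v]
    by (simp only: h_def)
  also have "\<dots> = (\<Sum>m<p. higher_deriv f (replicate m h @ [v]) x / fact m)"
  proof (intro sum.cong refl)
    fix m assume "m \<in> {..<p}"
    then have "m \<le> k" using pk by simp
    from perm[OF this] show "higher_deriv f (v # replicate m h) x / fact m = higher_deriv f (replicate m h @ [v]) x / fact m"
      by (simp only:)
  qed
  also have "\<dots> = (\<Sum>m<k. higher_deriv f (replicate m h @ [v]) x / fact m) + higher_deriv f (replicate k h @ [v]) x / fact k"
    unfolding pk by (rule sum.lessThan_Suc)
  finally have T: "frechet_derivative (taylor f p x) (at y) v = \<dots>" .
  let ?P = "\<lambda>hs. higher_deriv f hs (x + t *\<^sub>R h) - higher_deriv f hs x"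
  have "blinfun_apply (grad f y) v = higher_deriv f [v] (x + h)"
    by (simp add: grad_apply[OF f_differentiable] h_def)
  then have "blinfun_apply (grad f y) v - frechet_derivative (taylor f p x) (at y) v
      = ?P (v # replicate k h) / fact k"
    unfolding T t(3) by (simp only: perm[of k] order_refl diff_divide_distrib)
  then have "\<bar>blinfun_apply (grad f y) v - frechet_derivative (taylor f p x) (at y) v\<bar> = \<bar>?P (v # replicate k h)\<bar> / fact k"
    by simp
  also have "\<dots> \<le> (real (Suc k) ^ Suc k / fact (Suc k) * (Hf * \<parallel>h\<parallel> powr \<nu>) * \<parallel>h\<parallel> ^ k * \<parallel>v\<parallel>) / fact k"
  proof (intro divide_right_mono mixed_form_bound)
    show "sym_multilinear (Suc k) ?P" using sym_multilinear_diff_deriv pk by simp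
    show "\<bar>?P (replicate (Suc k) u)\<bar> \<le> Hf * \<parallel>h\<parallel> powr \<nu> * \<parallel>u\<parallel> ^ Suc k" for u
      using diff_deriv_diag_bound[OF t(1,2)] pk by simp
  qed (use Hf_nonneg in auto)
  also have "\<dots> = real p ^ p / fact p * (Hf / fact k) * (\<parallel>h\<parallel> powr \<nu> * \<parallel>h\<parallel> ^ k) * \<parallel>v\<parallel>"
    by (simp add: pk)
  also have "\<parallel>h\<parallel> powr \<nu> * \<parallel>h\<parallel> ^ k = \<parallel>h\<parallel> powr (real p + \<nu> - 1)"
    using powr_power_add[of k h \<nu>] k pk by simp
  finally show ?thesis by (simp add: h_def k_def)
qed

text \<open>The gradient of \<open>f\<close> is split into the Taylor error, the gradient of the
  model, which is at most the \<theta> term, and minus the gradient of the regularizer.\<close>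

lemma grad_bound:
  assumes tr: "trial_point B f p \<alpha> \<theta> H x y" and "0 \<le> \<alpha>" "H \<ge> 0"
  shows "dual_norm B (grad f y) \<le> real p ^ p / fact p * (Hf / fact (p - 1)) * \<parallel>y - x\<parallel> powr (real p + \<nu> - 1)
    + (H / fact p * (real p + \<alpha>) + \<theta>) * \<parallel>y - x\<parallel> powr (real p + \<alpha> - 1)"
proof (rule dual_norm_le)
  fix v
  define q where "q = real p + \<alpha>"
  have q: "q \<ge> 2" using p2 assms by (simp add: q_def)
  define h where "h = y - x"
  have shift: "((\<lambda>y. y - x) has_derivative (\<lambda>v. v)) (at y)"
    by (auto intro!: derivative_eq_intros)
  define T where "T = frechet_derivative (taylor f p x) (at y)"
  have T: "(taylor f p x has_derivative T) (at y)"
    unfolding T_def frechet_derivative_works[symmetric]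
    by (rule differentiableI[OF taylor_has_derivative[OF td]])
  have R: "(reg_model B f p \<alpha> H x has_derivative (\<lambda>v. T v + H / fact p * (q * \<parallel>h\<parallel> powr (q - 2) * \<langle>h,v\<rangle>))) (at y)"
    using has_derivative_add[OF T has_derivative_mult_right[OF has_derivative_compose[OF shift
      nrm_powr_has_derivative[OF q, of "y - x"]], of "H / fact p"]]
    unfolding reg_model_def[abs_def] q_def h_def by simp
  have G: "blinfun_apply (grad (reg_model B f p \<alpha> H x) y) v = T v + H / fact p * (q * \<parallel>h\<parallel> powr (q - 2) * \<langle>h,v\<rangle>)"
    unfolding grad_apply[OF differentiableI[OF R]] frechet_derivative_at[OF R, symmetric] by (rule refl)
  have "\<parallel>h\<parallel> powr (q - 2) * \<bar>\<langle>h,v\<rangle>\<bar> \<le> \<parallel>h\<parallel> powr (q - 2) * (\<parallel>h\<parallel> * \<parallel>v\<parallel>)"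
    using cauchy_schwarz by (intro mult_left_mono) auto
  also have "\<dots> = \<parallel>h\<parallel> powr (q - 1) * \<parallel>v\<parallel>"
    using powr_power_add[of 1 h "q - 2"] by (simp add: mult_ac)
  finally have "H / fact p * q * (\<parallel>h\<parallel> powr (q - 2) * \<bar>\<langle>h,v\<rangle>\<bar>) \<le> H / fact p * q * (\<parallel>h\<parallel> powr (q - 1) * \<parallel>v\<parallel>)"
    using assms q by (intro mult_left_mono) auto
  moreover have "\<bar>H / fact p * (q * \<parallel>h\<parallel> powr (q - 2) * \<langle>h,v\<rangle>)\<bar> = H / fact p * q * (\<parallel>h\<parallel> powr (q - 2) * \<bar>\<langle>h,v\<rangle>\<bar>)"
    using assms q by (simp add: abs_mult)
  ultimately have 2: "\<bar>H / fact p * (q * \<parallel>h\<parallel> powr (q - 2) * \<langle>h,v\<rangle>)\<bar> \<le> H / fact p * q * \<parallel>h\<parallel> powr (q - 1) * \<parallel>v\<parallel>"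
    by (simp add: mult.assoc)
  have "\<bar>blinfun_apply (grad (reg_model B f p \<alpha> H x) y) v\<bar> \<le> dual_norm B (grad (reg_model B f p \<alpha> H x) y) * \<parallel>v\<parallel>"
    by (rule dual_norm_bound)
  also have "\<dots> \<le> \<theta> * \<parallel>h\<parallel> powr (q - 1) * \<parallel>v\<parallel>"
    using tr by (intro mult_right_mono) (auto simp: trial_point_def h_def q_def)
  finally have 3: "\<bar>T v + H / fact p * (q * \<parallel>h\<parallel> powr (q - 2) * \<langle>h,v\<rangle>)\<bar> \<le> \<theta> * \<parallel>h\<parallel> powr (q - 1) * \<parallel>v\<parallel>"
    by (simp add: G)
  have 1: "\<bar>blinfun_apply (grad f y) v - T v\<bar> \<le> real p ^ p / fact p * (Hf / fact (p - 1)) * \<parallel>h\<parallel> powr (real p + \<nu> - 1) * \<parallel>v\<parallel>"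
    using taylor_grad_error[of y v x] by (simp add: T_def h_def)
  have "blinfun_apply (grad f y) v \<le> real p ^ p / fact p * (Hf / fact (p - 1)) * \<parallel>h\<parallel> powr (real p + \<nu> - 1) * \<parallel>v\<parallel>
     + (H / fact p * q * \<parallel>h\<parallel> powr (q - 1) * \<parallel>v\<parallel> + \<theta> * \<parallel>h\<parallel> powr (q - 1) * \<parallel>v\<parallel>)"
  proof -
    have "g \<le> a + (b + c)" if "\<bar>g - t\<bar> \<le> a" "\<bar>w\<bar> \<le> b" "\<bar>t + w\<bar> \<le> c" for g t a b c w :: real
      using that by linarith
    from this[OF 1 2 3] show ?thesis .
  qed
  also have "\<dots> = (real p ^ p / fact p * (Hf / fact (p - 1)) * \<parallel>h\<parallel> powr (real p + \<nu> - 1)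
     + (H / fact p * q + \<theta>) * \<parallel>h\<parallel> powr (q - 1)) * \<parallel>v\<parallel>"
    by (simp add: distrib_left distrib_right mult_ac)
  finally show "blinfun_apply (grad f y) v \<le> (real p ^ p / fact p * (Hf / fact (p - 1)) * \<parallel>y - x\<parallel> powr (real p + \<nu> - 1)
    + (H / fact p * (real p + \<alpha>) + \<theta>) * \<parallel>y - x\<parallel> powr (real p + \<alpha> - 1)) * \<parallel>v\<parallel>"
    by (simp add: h_def q_def)
qed

lemma model_decrease:
  assumes tr: "trial_point B f p \<alpha> \<theta> H x y"
  shows "f x - f y \<ge> H / fact p * \<parallel>y - x\<parallel> powr (real p + \<alpha>) - Hf / fact p * \<parallel>y - x\<parallel> powr (real p + \<nu>)"
  using tr taylor_error[of y x] by (auto simp: trial_point_def reg_model_def)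

lemma convex_grad: "f y \<ge> f x + blinfun_apply (grad f x) (y - x)"
proof -
  have cv: "convex_on UNIV (\<lambda>t. f (x + t *\<^sub>R (y - x)))"
  proof (rule convex_onI)
    fix t a b :: real assume t: "0 < t" "t < 1"
    have "x + ((1 - t) *\<^sub>R a + t *\<^sub>R b) *\<^sub>R (y - x) = (1 - t) *\<^sub>R (x + a *\<^sub>R (y - x)) + t *\<^sub>R (x + b *\<^sub>R (y - x))"
      by (simp add: algebra_simps)
    then show "f (x + ((1 - t) *\<^sub>R a + t *\<^sub>R b) *\<^sub>R (y - x)) \<le> (1 - t) * f (x + a *\<^sub>R (y - x)) + t * f (x + b *\<^sub>R (y - x))"
      using convex_onD[OF cvx, of t "x + a *\<^sub>R (y - x)" "x + b *\<^sub>R (y - x)"] t by simp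
  qed simp
  have "((\<lambda>t. f (x + t *\<^sub>R (y - x))) has_real_derivative frechet_derivative f (at (x + 0 *\<^sub>R (y - x))) (y - x)) (at 0)"
    by (rule line_has_derivative[OF f_differentiable])
  then have "f (x + 1 *\<^sub>R (y - x)) - f (x + 0 *\<^sub>R (y - x)) \<ge> frechet_derivative f (at x) (y - x) * (1 - 0)"
    by (intro convex_on_imp_above_tangent[OF cv]) (auto intro: has_field_derivative_at_within)
  then show ?thesis by (simp add: grad_apply[OF f_differentiable])
qed

lemma grad_lower: "f y - f z \<le> dual_norm B (grad f y) * \<parallel>y - z\<parallel>"
  using convex_grad[of y z] dual_norm_bound[of "grad f y" "z - y"] by (simp add: nrm_minus_commute)

end

section \<open>Numerical estimates\<close>

text \<open>Equality at 3 fixes the constant 9/4. From n to n + 1 the left side grows by (n + 1) (1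
  + 1/n)^n, at most 3 (n + 1), and the right side by (n + 1) n.\<close>

lemma power_self_le_fact:
  assumes "p \<ge> 3"
  shows "real p ^ p \<le> 9 / 4 * fact p * fact (p - 1)"
  using assms
proof (induction p rule: nat_induct_at_least)
  case base
  then show ?case by (simp add: fact_numeral numeral_eq_Suc)
next
  case (Suc n)
  have n: "real n \<ge> 3" using Suc by simp
  have "(1 + 1 / real n) ^ n \<le> exp 1"
    using exp_ge_one_plus_x_over_n_power_n[of n 1] n by simp
  also have "\<dots> \<le> real n" using exp_le n by linarith
  finally have "(1 + 1 / real n) ^ n * real n ^ n \<le> real n * real n ^ n"
    by (intro mult_right_mono) auto
  also have "(1 + 1 / real n) ^ n * real n ^ n = real (Suc n) ^ n"
  proof -
    have "(1 + 1 / real n) * real n = real (Suc n)" using n by (simp add: field_simps)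
    then show ?thesis by (metis power_mult_distrib)
  qed
  finally have "real (Suc n) ^ Suc n \<le> real (Suc n) * (real n * real n ^ n)"
    by simp
  also have "\<dots> \<le> real (Suc n) * (real n * (9 / 4 * fact n * fact (n - 1)))"
    using Suc.IH by (intro mult_left_mono) auto
  also have "\<dots> = 9 / 4 * fact (Suc n) * (real n * fact (n - 1))" by simp
  also have "real n * fact (n - 1) = fact n" using n by (simp add: fact_reduce)
  finally show ?case by simp
qed

text \<open>These are the shares of the Taylor error and of the regularizer in the gradient
  constant. Together with a share of at most 1 for \<theta> they give the bound 4.\<close>

lemma polarization_const_bounds:
  assumes "p \<ge> 2"
  shows "2 / 3 * (real p ^ p / fact p) / fact (p - 1) \<le> 3 / 2"
    and "(real p + 1) / fact p \<le> 3 / 2"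
proof -
  show "2 / 3 * (real p ^ p / fact p) / fact (p - 1) \<le> 3 / 2"
  proof (cases "p = 2")
    case True then show ?thesis by (simp add: fact_numeral)
  next
    case False
    then have "real p ^ p \<le> 9 / 4 * fact p * fact (p - 1)" using assms by (intro power_self_le_fact) simp
    then show ?thesis by (simp add: field_simps)
  qed
  show "(real p + 1) / fact p \<le> 3 / 2"
  proof (cases "p = 2")
    case True then show ?thesis by (simp add: fact_numeral)
  next
    case False
    then have p: "p \<ge> 3" using assms by simp
    have "(2::real) = fact 2" by (simp add: fact_numeral)
    also have "\<dots> \<le> fact (p - 1)" using p by (intro fact_mono) simp
    finally have "real p * 2 \<le> real p * fact (p - 1)" by (intro mult_left_mono) auto
    also have "\<dots> = fact p" using p by (simp add: fact_reduce)
    finally show ?thesis using p by (simp add: field_simps)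
  qed
qed

text \<open>For \<open>s \<ge> 3\<close> the exponent is at most 3/2, and 4^(3/2) = 8, which is the
  value of the right side at \<open>p = 2\<close>.\<close>

lemma four_powr_bound:
  fixes K s :: real
  assumes "0 \<le> K" "K \<le> 4" "s \<ge> 3" "p \<ge> (2::nat)"
  shows "K powr (s / (s - 1)) \<le> 8 * (real p + 1) / 3"
proof -
  have "K powr (s / (s - 1)) \<le> 4 powr (s / (s - 1))" using assms by (intro powr_mono2) auto
  also have "\<dots> \<le> 4 powr (3 / 2)" using assms by (intro powr_mono) (auto simp: field_simps)
  also have "(4::real) powr (3 / 2) = ((2::real) powr 2) powr (3 / 2)" by (simp add: powr_numeral)
  also have "\<dots> = 2 powr 3" by (subst powr_powr) simp
  also have "\<dots> = 8" by (simp add: powr_numeral)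
  finally show ?thesis using assms by simp
qed

text \<open>Only \<open>p = 2\<close> is delicate: the exponent (2 + \<nu>) / (1 + \<nu>) can reach
  2, too much for the crude bound 4. There K equals 8/3 + \<nu>/2 and is compared directly with
  8^((1 + \<nu>) / (2 + \<nu>)).\<close>

lemma known_const_bound:
  assumes p: "p \<ge> 2" and nu: "0 \<le> \<nu>" "\<nu> \<le> 1"
    and K: "K = 2 / 3 * (real p ^ p / fact p) / fact (p - 1) + (real p + \<nu>) / fact p + 1 / (3 * fact (p - 1))"
  shows "K powr ((real p + \<nu>) / (real p + \<nu> - 1)) \<le> 8 * (real p + 1) / 3"
proof (cases "p = 2")
  case True
  have K2: "K = 8 / 3 + \<nu> / 2" unfolding K True by (simp add: fact_numeral field_simps)
  \<comment> \<open>The left side is the chord over [0, 1] of the concave function on the right; it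
    makes the exponent linear in \<nu>.\<close>
  have e: "1 / 2 + \<nu> / 6 \<le> (1 + \<nu>) / (2 + \<nu>)"
  proof -
    have "\<nu> * \<nu> \<le> \<nu>" using nu by (simp add: mult_left_le)
    then show ?thesis using nu by (simp add: field_simps)
  qed
  have s8: "8 / 3 \<le> sqrt 8" by (rule real_le_rsqrt) (simp add: power2_eq_square)
  have ln8: "ln (8::real) \<ge> 2"
  proof -
    have "ln (8::real) = ln (2 ^ 3)" by simp
    also have "\<dots> = 3 * ln 2" by (subst ln_realpow) simp_all
    finally show ?thesis using ln2_ge_two_thirds by simp
  qed
  have "K \<le> 8 / 3 * (1 + \<nu> / 3)" using nu K2 by (simp add: field_simps)
  also have "\<dots> \<le> sqrt 8 * (1 + \<nu> / 3)" using s8 nu by (intro mult_right_mono) auto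
  also have "\<dots> \<le> sqrt 8 * exp (\<nu> / 6 * ln 8)"
  proof (rule mult_left_mono)
    have "\<nu> / 3 \<le> \<nu> / 6 * ln 8" using mult_left_mono[OF ln8, of "\<nu> / 6"] nu by simp
    then show "1 + \<nu> / 3 \<le> exp (\<nu> / 6 * ln 8)"
      using exp_ge_add_one_self[of "\<nu> / 6 * ln 8"] by linarith
  qed simp
  also have "\<dots> = 8 powr (1 / 2 + \<nu> / 6)"
    by (simp add: powr_add powr_half_sqrt) (simp add: powr_def)
  also have "\<dots> \<le> 8 powr ((1 + \<nu>) / (2 + \<nu>))" using e by (intro powr_mono) auto
  finally have "K powr ((2 + \<nu>) / (1 + \<nu>)) \<le> (8 powr ((1 + \<nu>) / (2 + \<nu>))) powr ((2 + \<nu>) / (1 + \<nu>))"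
    using nu K2 by (intro powr_mono2) auto
  also have "\<dots> = 8" using nu by (simp add: powr_powr)
  finally show ?thesis using True by simp
next
  case False
  then have p3: "p \<ge> 3" using p by simp
  have "(real p + \<nu>) / fact p \<le> (real p + 1) / fact p" using nu by (intro divide_right_mono) auto
  moreover have "1 / (3 * fact (p - 1)) \<le> (1 :: real)"
  proof -
    have "(1::real) \<le> fact (p - 1)" by (rule fact_ge_1)
    then have "1 \<le> 3 * (fact (p - 1) :: real)" by linarith
    then show ?thesis by simp
  qed
  ultimately have "K \<le> 4" using polarization_const_bounds[OF p] unfolding K by linarith
  moreover have "K \<ge> 0" unfolding K using nu by simp
  ultimately show ?thesis using p3 nu p by (intro four_powr_bound) auto
qed

text \<open>The step length \<open>r\<close> is eliminated between the two bounds. The threshold 8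
  (p + 1) / 3 is the quotient of the constant 8 (p + 1)! of the test by the 3 p! of the
  decrease.\<close>

lemma decrease_from_bounds:
  fixes K H r g dec s :: real
  assumes s: "s \<ge> 2" and K: "K \<ge> 0" "K powr (s / (s - 1)) \<le> 8 * (real p + 1) / 3"
    and H: "H > 0" and r: "r \<ge> 0" and g: "0 \<le> g" "g \<le> K * H * r powr (s - 1)"
    and dec: "dec \<ge> H / (3 * fact p) * r powr s"
  shows "dec \<ge> 1 / (8 * fact (p + 1) * H powr (1 / (s - 1))) * g powr (s / (s - 1))"
proof -
  have ne: "s - 1 > 0" using s by simp
  have "g powr (s / (s - 1)) \<le> (K * H * r powr (s - 1)) powr (s / (s - 1))"
    using g s by (intro powr_mono2) auto
  also have "\<dots> = K powr (s / (s - 1)) * (H powr (s / (s - 1)) * r powr s)"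
    using K H r ne by (simp add: powr_mult powr_powr)
  also have "H powr (s / (s - 1)) = H powr (1 / (s - 1)) * H"
  proof -
    have "s / (s - 1) = 1 / (s - 1) + 1" using ne by (simp add: field_simps)
    then show ?thesis using H by (simp add: powr_add)
  qed
  also have "K powr (s / (s - 1)) * (H powr (1 / (s - 1)) * H * r powr s)
      \<le> 8 * (real p + 1) / 3 * (H powr (1 / (s - 1)) * H * r powr s)"
    using K H by (intro mult_right_mono) auto
  finally have "g powr (s / (s - 1)) \<le> 8 * (real p + 1) / 3 * (H powr (1 / (s - 1)) * H * r powr s)" .
  then have "1 / (8 * fact (p + 1) * H powr (1 / (s - 1))) * g powr (s / (s - 1))
     \<le> 1 / (8 * fact (p + 1) * H powr (1 / (s - 1))) * (8 * (real p + 1) / 3 * (H powr (1 / (s - 1)) * H * r powr s))"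
    using H by (intro mult_left_mono) auto
  also have "\<dots> = H / (3 * fact p) * r powr s"
  proof -
    define e where "e = H powr (1 / (s - 1))"
    have e: "e > 0" using H by (simp add: e_def)
    have "fact (p + 1) = (real p + 1) * fact p" by (simp add: algebra_simps)
    then show ?thesis unfolding e_def[symmetric] using e H
      by (simp add: divide_simps del: fact_Suc)
  qed
  finally show ?thesis using dec by linarith
qed

section \<open>Scalar recursions behind the two phases of convergence\<close>

lemma superlinear_phase:
  fixes u :: "nat \<Rightarrow> real"
  assumes q: "q > 0" and big: "\<And>t. t < m \<Longrightarrow> u t > 2"
    and rec: "\<And>t. Suc t < m \<Longrightarrow> u (Suc t) powr (1 + 1 / q) \<le> u t"
  shows "int m \<le> \<lceil>1 / ln ((q + 1) / q) * ln (max 1 (log 2 (u 0)))\<rceil>"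
proof -
  define X where "X = 1 / ln ((q + 1) / q) * ln (max 1 (log 2 (u 0)))"
  define \<rho> where "\<rho> = (q + 1) / q"
  have rho: "\<rho> > 1" using q by (simp add: \<rho>_def)
  then have lr: "ln \<rho> > 0" by simp
  have "X \<ge> 0" using lr by (simp add: X_def \<rho>_def[symmetric])
  have "int m \<le> \<lceil>X\<rceil>"
  proof (cases m)
    case 0 then show ?thesis using \<open>X \<ge> 0\<close> by simp
  next
    case (Suc k)
    have "log 2 (u j) * \<rho> ^ j \<le> log 2 (u 0)" if "j \<le> k" for j
      using that
    proof (induction j)
      case 0 then show ?case by simp
    next
      case (Suc j)
      have "Suc j < m" using Suc.prems \<open>m = Suc k\<close> by simp
      have pos: "u (Suc j) > 2" "u j > 2" using big \<open>Suc j < m\<close> by auto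
      have "log 2 (u (Suc j) powr (1 + 1 / q)) \<le> log 2 (u j)"
        using rec[OF \<open>Suc j < m\<close>] pos by (subst log_le_cancel_iff) auto
      then have "log 2 (u (Suc j)) * \<rho> \<le> log 2 (u j)"
        using pos q by (simp add: log_powr \<rho>_def field_simps)
      then have "log 2 (u (Suc j)) * \<rho> * \<rho> ^ j \<le> log 2 (u j) * \<rho> ^ j"
        using rho by (intro mult_right_mono) auto
      then show ?case using Suc by (simp add: mult.assoc)
    qed
    from this[of k] have k: "log 2 (u k) * \<rho> ^ k \<le> log 2 (u 0)" by simp
    \<comment> \<open>The threshold 2 matches the base of the logarithm, so only the geometric
      factor remains.\<close>
    have "log 2 (u k) > 1" using big[of k] Suc by (simp add: less_log_iff)
    then have "1 * \<rho> ^ k < log 2 (u k) * \<rho> ^ k" using rho by (intro mult_strict_right_mono) auto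
    then have lt: "\<rho> ^ k < max 1 (log 2 (u 0))" using k by linarith
    then have "ln (\<rho> ^ k) < ln (max 1 (log 2 (u 0)))"
      using rho by (subst ln_less_cancel_iff) auto
    then have "real k * ln \<rho> < ln (max 1 (log 2 (u 0)))"
      using rho by (simp add: ln_realpow)
    then have "real k < X" unfolding X_def \<rho>_def[symmetric] using lr by (simp add: pos_less_divide_eq)
    \<comment> \<open>The index \<open>k = m - 1\<close> is the last one known to lie above the
      threshold. The strict bound therefore holds for \<open>m - 1\<close>, which for the integer
      \<open>m\<close> means the ceiling.\<close>
    then have "int k < \<lceil>X\<rceil>" by (simp add: less_ceiling_iff)
    then show ?thesis using Suc by simp
  qed
  then show ?thesis by (simp add: X_def)
qed

text \<open>Bernoulli's inequality for exponents in [0, 1], read as weighted AM-GM for 1 and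
  \<open>s\<close> and taken from convexity of \<open>exp\<close>.\<close>

lemma powr_le_tangent:
  fixes s a :: real
  assumes "s > 0" "0 \<le> a" "a \<le> 1"
  shows "s powr a \<le> 1 + a * (s - 1)"
proof -
  have "exp ((1 - a) *\<^sub>R 0 + a *\<^sub>R ln s) \<le> (1 - a) * exp 0 + a * exp (ln s)"
    using exp_convex assms by (intro convex_onD) auto
  then show ?thesis using assms by (simp add: powr_def algebra_simps)
qed

text \<open>With \<open>y = v powr (- (1 / q))\<close> the recursion reads
  \<open>v * (1 + 1 / y) \<le> u\<close>, and Bernoulli's inequality gives a growth of at least y /
  (q (1 + y)). The lower bound 1/2 turns this into 1 / (3 q).\<close>

lemma inverse_power_step:
  fixes u v q :: real
  assumes q: "q \<ge> 1" and v: "v > 0" and uv: "v + v powr (1 + 1 / q) \<le> u"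
    and w: "u powr (- (1 / q)) \<ge> 1 / 2"
  shows "u powr (- (1 / q)) + 1 / (3 * q) \<le> v powr (- (1 / q))"
proof -
  define y where "y = v powr (- (1 / q))"
  have y: "y > 0" using v by (simp add: y_def)
  have vy: "v powr (1 / q) = 1 / y" by (simp add: y_def powr_minus_divide)
  have uv': "v * (1 + 1 / y) \<le> u" using uv v by (simp add: powr_add vy algebra_simps)
  have pos: "v * (1 + 1 / y) > 0" using v y by (simp add: add_pos_pos)
  have "u powr (- (1 / q)) \<le> (v * (1 + 1 / y)) powr (- (1 / q))"
    using uv' pos q by (intro powr_mono2') auto
  also have "\<dots> = y * (1 + 1 / y) powr (- (1 / q))"
    using v y by (simp add: powr_mult y_def)
  also have "(1 + 1 / y) powr (- (1 / q)) = (y / (1 + y)) powr (1 / q)"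
  proof -
    have "1 + 1 / y = (1 + y) / y" using y by (simp add: field_simps)
    then show ?thesis using y by (simp add: powr_minus powr_divide)
  qed
  also have "y * (y / (1 + y)) powr (1 / q) \<le> y * (1 + 1 / q * (y / (1 + y) - 1))"
    using y q by (intro mult_left_mono powr_le_tangent) auto
  also have "\<dots> = y - 1 / q * (y / (1 + y))"
    using y q by (simp add: field_simps)
  finally have le: "u powr (- (1 / q)) \<le> y - 1 / q * (y / (1 + y))" .
  have "1 / q * (y / (1 + y)) \<ge> 0" using y q by simp
  \<comment> \<open>The growth term is nonnegative, so \<open>y\<close> inherits the lower bound
    from \<open>u\<close>.\<close>
  then have "y \<ge> 1 / 2" using le w by linarith
  then have "y / (1 + y) \<ge> 1 / 3" by (simp add: field_simps)
  then have "1 / q * (1 / 3) \<le> 1 / q * (y / (1 + y))" using q by (intro mult_left_mono) auto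
  then show ?thesis using le by (simp add: y_def)
qed

lemma sublinear_phase:
  fixes u :: "nat \<Rightarrow> real"
  assumes q: "q \<ge> 1" and um: "u m \<le> 2" and pos: "\<And>t. t \<le> T \<Longrightarrow> u t > 0"
    and rec: "\<And>t. t < T \<Longrightarrow> u (Suc t) + u (Suc t) powr (1 + 1 / q) \<le> u t"
    and mT: "m < T"
  shows "u T \<le> (3 * q / real (T - m)) powr q"
proof -
  have "u (m + k) powr (- (1 / q)) \<ge> 1 / 2 + real k / (3 * q)" if "m + k \<le> T" for k
    using that
  proof (induction k)
    case 0
    \<comment> \<open>The starting value 1/2 comes from \<open>u m \<le> 2\<close> and
      \<open>q \<ge> 1\<close>.\<close>
    have "(1::real) / 2 = 2 powr (- 1)" by (simp add: powr_minus)
    also have "\<dots> \<le> 2 powr (- (1 / q))" using q by (intro powr_mono) (auto simp: field_simps)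
    also have "\<dots> \<le> u m powr (- (1 / q))" using um pos[of m] mT q by (intro powr_mono2') auto
    finally show ?case by simp
  next
    case (Suc k)
    have IH: "1 / 2 + real k / (3 * q) \<le> u (m + k) powr (- (1 / q))" using Suc by simp
    have "u (m + k) powr (- (1 / q)) + 1 / (3 * q) \<le> u (Suc (m + k)) powr (- (1 / q))"
    proof (rule inverse_power_step[OF q])
      have "real k / (3 * q) \<ge> 0" using q by simp
      then show "1 / 2 \<le> u (m + k) powr (- (1 / q))" using IH by linarith
    qed (use pos[of "Suc (m + k)"] rec[of "m + k"] Suc.prems in auto)
    then show ?case using IH by (simp add: add_divide_distrib)
  qed
  from this[of "T - m"] have "u T powr (- (1 / q)) \<ge> 1 / 2 + real (T - m) / (3 * q)" using mT by simp
  \<comment> \<open>The initial 1/2 has done its work in the growth estimate and is dropped.\<close>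
  then have le: "real (T - m) / (3 * q) \<le> u T powr (- (1 / q))" by linarith
  have k: "real (T - m) > 0" using mT by simp
  have "u T = (u T powr (- (1 / q))) powr (- q)"
    using q pos[of T] by (simp add: powr_powr)
  also have "\<dots> \<le> (real (T - m) / (3 * q)) powr (- q)"
    using le k q by (intro powr_mono2') auto
  also have "\<dots> = (3 * q / real (T - m)) powr q"
    using k q by (simp add: powr_minus powr_divide)
  finally show ?thesis .
qed

section \<open>Acceptance of trial points\<close>

context holder_smooth begin

text \<open>For \<alpha> = \<nu> the Taylor error and the regularizer have the same degree, so only
  coefficients are compared: \<open>Hf \<le> 2 / 3 * H\<close> leaves H / 3 in the decrease.\<close>

lemma accept_known:
  assumes tr: "trial_point B f p \<nu> \<theta> H x y" and H: "H > 0"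
    and HN: "H \<ge> 3 * Hf / 2" "H \<ge> 3 * \<theta> * fact (p - 1)"
  shows "sufficient_decrease B f p \<nu> H x y"
proof -
  define r where "r = \<parallel>y - x\<parallel>"
  define s where "s = real p + \<nu>"
  define c where "c = real p ^ p / fact p"
  \<comment> \<open>The summands stem from the Taylor error (2/3 because
    \<open>Hf \<le> 2 / 3 * H\<close>), the regularizer, and the inexactness \<theta>.\<close>
  define K where "K = 2 / 3 * c / fact (p - 1) + (real p + \<nu>) / fact p + 1 / (3 * fact (p - 1))"
  have c: "c \<ge> 0" by (simp add: c_def)
  have s: "s \<ge> 2" using p2 nu0 by (simp add: s_def)
  have th: "\<theta> \<le> H * (1 / (3 * fact (p - 1)))" using HN(2) by (simp add: field_simps)
  have "dual_norm B (grad f y) \<le> c * (Hf / fact (p - 1)) * r powr (s - 1) + (H / fact p * s + \<theta>) * r powr (s - 1)"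
    using grad_bound[OF tr nu0] H by (simp add: r_def s_def c_def)
  also have "\<dots> = (c / fact (p - 1) * Hf + (H / fact p * s + \<theta>)) * r powr (s - 1)"
    by (simp add: algebra_simps)
  also have "\<dots> \<le> (c / fact (p - 1) * (2 / 3 * H) + (H / fact p * s + H * (1 / (3 * fact (p - 1))))) * r powr (s - 1)"
    using HN(1) th c by (intro mult_right_mono add_mono mult_left_mono order_refl) auto
  also have "\<dots> = K * H * r powr (s - 1)"
    by (simp add: K_def s_def algebra_simps)
  finally have g: "dual_norm B (grad f y) \<le> K * H * r powr (s - 1)" .
  have "H / 3 * r powr s \<le> (H - Hf) * r powr s" using HN(1) by (intro mult_right_mono) auto
  then have "H / 3 * r powr s / fact p \<le> (H - Hf) * r powr s / fact p" by (intro divide_right_mono) auto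
  also have "\<dots> = H / fact p * r powr s - Hf / fact p * r powr s"
    by (simp add: algebra_simps diff_divide_distrib)
  also have "\<dots> \<le> f x - f y" using model_decrease[OF tr] by (simp add: r_def s_def)
  finally have dec: "f x - f y \<ge> H / (3 * fact p) * r powr s" by simp
  have "K \<ge> 0" using c nu0 by (simp add: K_def)
  moreover have "K powr (s / (s - 1)) \<le> 8 * (real p + 1) / 3"
    unfolding s_def by (rule known_const_bound[OF p2 nu0 nu1]) (simp add: K_def c_def)
  ultimately show ?thesis
    using decrease_from_bounds[OF s _ _ H _ _ g dec] by (simp add: sufficient_decrease_def s_def r_def)
qed

text \<open>Scaling \<open>y\<close> towards the minimizer down to the level \<open>f xs + \<epsilon>\<close> bounds the gradient at \<open>y\<close>
  from below.\<close>

lemma grad_lower_level: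
  assumes eps: "\<epsilon> > 0" and y: "f y - f xs \<ge> \<epsilon>" and bdd: "bdd_above {\<parallel>x - xs\<parallel> | x. f x \<le> f xs + \<epsilon>}"
  shows "level_radius B f xs \<epsilon> > 0" "\<epsilon> \<le> dual_norm B (grad f y) * level_radius B f xs \<epsilon>"
proof -
  define F where "F t = f (xs + t *\<^sub>R (y - xs))" for t
  have "continuous_on {0..1} F"
    using line_has_derivative[OF f_differentiable] unfolding F_def
    by (intro DERIV_atLeastAtMost_imp_continuous_on) blast
  then have "\<exists>t. 0 \<le> t \<and> t \<le> 1 \<and> F t = f xs + \<epsilon>"
    using eps y by (intro IVT') (auto simp: F_def)
  then obtain t where t: "0 \<le> t" "t \<le> 1" "F t = f xs + \<epsilon>" by blast
  define z where "z = xs + t *\<^sub>R (y - xs)"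
  have z: "f z = f xs + \<epsilon>" using t by (simp add: z_def F_def)
  then have "z \<noteq> xs" using eps by auto
  then have zp: "\<parallel>z - xs\<parallel> > 0" by (simp add: nrm_pos_iff)
  have zR: "\<parallel>z - xs\<parallel> \<le> level_radius B f xs \<epsilon>"
    unfolding level_radius_def using z by (intro cSup_upper[OF _ bdd]) auto
  then show "level_radius B f xs \<epsilon> > 0" using zp by linarith
  \<comment> \<open>Convexity costs a factor \<open>t\<close> in the function gap, and the same
    \<open>t\<close> relates the distances of \<open>z\<close> and \<open>y\<close> to
    \<open>xs\<close>; so the level radius applies although \<open>y\<close> may lie far outside the
    level set.\<close>
  have "f z \<le> (1 - t) * f xs + t * f y"
    using convex_onD[OF cvx, of t xs y] t by (simp add: z_def algebra_simps)
  then have "\<epsilon> \<le> t * (f y - f xs)" using z by (simp add: algebra_simps)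
  also have "\<dots> \<le> t * (dual_norm B (grad f y) * \<parallel>y - xs\<parallel>)"
    using t grad_lower by (intro mult_left_mono) auto
  also have "\<dots> = dual_norm B (grad f y) * \<parallel>z - xs\<parallel>"
    using t by (simp add: z_def nrm_scale)
  also have "\<dots> \<le> dual_norm B (grad f y) * level_radius B f xs \<epsilon>"
    using zR by (intro mult_left_mono) auto
  finally show "\<epsilon> \<le> dual_norm B (grad f y) * level_radius B f xs \<epsilon>" .
qed

text \<open>A step with \<open>H * r powr (1 - \<nu>) < 3 * Hf / 2\<close> would force the gradient below \<open>\<epsilon> / R\<close>.\<close>

lemma step_length_bound:
  fixes H r g R \<epsilon> :: real
  assumes H: "H > 0" and R: "R > 0" and eps: "\<epsilon> > 0" and r: "r > 0"
    and HN: "H \<ge> (3 * Hf / 2) powr (real p / (real p + \<nu> - 1)) * (4 * R / \<epsilon>) powr ((1 - \<nu>) / (real p + \<nu> - 1))"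
    and gR: "\<epsilon> \<le> g * R"
    and g: "H * r powr (1 - \<nu>) < 3 * Hf / 2 \<Longrightarrow> g \<le> 4 * (3 * Hf / 2) * r powr (real p + \<nu> - 1)"
  shows "3 * Hf / 2 \<le> H * r powr (1 - \<nu>)"
proof (rule ccontr)
  assume "\<not> ?thesis"
  then have lt: "H * r powr (1 - \<nu>) < 3 * Hf / 2" by simp
  define G where "G = 3 * Hf / 2"
  define a where "a = real p + \<nu> - 1"
  define b where "b = (1 - \<nu>) / a"
  have a: "a > 0" using p2 nu0 by (simp add: a_def)
  have b: "b \<ge> 0" using a nu1 by (simp add: b_def)
  have G: "G > 0" using lt mult_nonneg_nonneg[OF less_imp_le[OF H] powr_ge_zero[of r "1 - \<nu>"]] unfolding G_def by linarith
  have "\<epsilon> \<le> 4 * G * r powr a * R"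
    using order_trans[OF gR mult_right_mono[OF g[OF lt], of R]] R by (simp add: G_def a_def)
  then have "\<epsilon> / (4 * R * G) \<le> r powr a" using R G by (simp add: field_simps)
  then have "(\<epsilon> / (4 * R * G)) powr b \<le> (r powr a) powr b"
    using eps R G b by (intro powr_mono2) auto
  also have "(r powr a) powr b = r powr (1 - \<nu>)" using a by (simp add: powr_powr b_def)
  finally have rb: "(\<epsilon> / (4 * R * G)) powr b \<le> r powr (1 - \<nu>)" .
  have "\<epsilon> / (4 * R * G) = inverse (4 * R / \<epsilon>) * inverse G" using R G eps by (simp add: field_simps)
  then have "(\<epsilon> / (4 * R * G)) powr b = inverse (4 * R / \<epsilon>) powr b * inverse G powr b"
    using R G eps by (simp only: powr_mult)
  also have "\<dots> = (4 * R / \<epsilon>) powr (- b) * G powr (- b)"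
    using R G eps by (simp only: powr_minus inverse_powr[of "4 * R / \<epsilon>"] inverse_powr[of G])
  finally have "(\<epsilon> / (4 * R * G)) powr b = (4 * R / \<epsilon>) powr (- b) * G powr (- b)" .
  \<comment> \<open>Multiplying the lower bounds on \<open>H\<close> and on
    \<open>r powr (1 - \<nu>)\<close> cancels the powers of \<open>4 * R / \<epsilon>\<close>. The
    exponents of \<open>G\<close> add up to (p - (1 - \<nu>)) / a = 1, which contradicts
    \<open>lt\<close>.\<close>
  then have "(G powr (real p / a) * (4 * R / \<epsilon>) powr b) * ((4 * R / \<epsilon>) powr (- b) * G powr (- b)) \<le> H * r powr (1 - \<nu>)"
    using HN rb H by (intro mult_mono) (auto simp: G_def a_def b_def)
  also have "(G powr (real p / a) * (4 * R / \<epsilon>) powr b) * ((4 * R / \<epsilon>) powr (- b) * G powr (- b))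
      = G powr (real p / a + (- b)) * (4 * R / \<epsilon>) powr (b + (- b))"
    unfolding powr_add by (simp only: mult_ac)
  also have "\<dots> = G powr (real p / a + (- b))" using R eps by simp
  also have "real p / a + (- b) = 1" using a by (simp add: b_def field_simps) (simp add: a_def)
  finally show False using lt G by (simp add: G_def)
qed

text \<open>The regularizer has degree p + 1 and the Taylor error only p + \<nu>, so the latter
  dominates for short steps. Once \<open>3 * Hf / 2 \<le> H * r powr (1 - \<nu>)\<close> is secured,
  the comparison runs as in the case \<alpha> = \<nu>.\<close>

lemma accept_unknown:
  assumes tr: "trial_point B f p 1 \<theta> H x y" and H: "H > 0" and th: "\<theta> \<ge> 0" "H \<ge> \<theta>"
    and R: "R = level_radius B f xs \<epsilon>"
    and HN: "H \<ge> (3 * Hf / 2) powr (real p / (real p + \<nu> - 1)) * (4 * R / \<epsilon>) powr ((1 - \<nu>) / (real p + \<nu> - 1))"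
    and eps: "\<epsilon> > 0" and y: "f y - f xs \<ge> \<epsilon>" and bdd: "bdd_above {\<parallel>x - xs\<parallel> | x. f x \<le> f xs + \<epsilon>}"
  shows "sufficient_decrease B f p 1 H x y"
proof -
  define r where "r = \<parallel>y - x\<parallel>"
  define g where "g = dual_norm B (grad f y)"
  define c where "c = real p ^ p / fact p"
  define a where "a = real p + \<nu> - 1"
  \<comment> \<open>\<open>d\<close> and \<open>e\<close> are the gradient coefficients relative to
    \<open>3 * Hf / 2 * r powr a\<close> and \<open>H * r powr p\<close>. Their sum is at most 4,
    which is the 4 in \<open>4 * R / \<epsilon>\<close>.\<close>
  define d where "d = 2 / 3 * c / fact (p - 1)"
  define e where "e = (real p + 1) / fact p + 1"
  have "d \<le> 3 / 2" "e \<le> 3 / 2 + 1"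
    using polarization_const_bounds[OF p2] by (simp_all only: d_def e_def c_def add_le_cancel_right)
  then have "d + e \<le> 4" by linarith
  then have de: "d \<ge> 0" "e \<ge> 0" "d + e \<le> 4"
    by (auto simp: d_def e_def c_def)
  have Rp: "R > 0" and gR: "\<epsilon> \<le> g * R"
    using grad_lower_level[OF eps y bdd] by (auto simp: R g_def)
  have "g \<le> c * (Hf / fact (p - 1)) * r powr a + (H / fact p * (real p + 1) + \<theta>) * r powr (real p)"
    using grad_bound[OF tr] H by (simp add: r_def g_def c_def a_def)
  also have "\<dots> \<le> c * (Hf / fact (p - 1)) * r powr a + (H / fact p * (real p + 1) + H) * r powr (real p)"
    using th by (intro add_left_mono mult_right_mono) auto
  also have "\<dots> = d * (3 * Hf / 2) * r powr a + e * (H * r powr (real p))"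
    by (simp add: d_def e_def algebra_simps)
  finally have g: "g \<le> d * (3 * Hf / 2) * r powr a + e * (H * r powr (real p))" .
  \<comment> \<open>A step of length zero would make the gradient bound vanish, against
    \<open>\<epsilon> \<le> g * R\<close>.\<close>
  have rp: "r > 0"
  proof (rule ccontr)
    assume "\<not> r > 0"
    then have "r = 0" using nrm_nonneg[of "y - x"] by (simp add: r_def)
    then have "g * R \<le> 0" using g Rp by (simp add: mult_nonpos_nonneg)
    then show False using gR eps by simp
  qed
  have split: "r powr (real p) = r powr (1 - \<nu>) * r powr a"
    using rp by (simp add: powr_add[symmetric] a_def)
  have key: "3 * Hf / 2 \<le> H * r powr (1 - \<nu>)"
  proof (rule step_length_bound[OF H Rp eps rp HN gR])
    assume lt: "H * r powr (1 - \<nu>) < 3 * Hf / 2"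
    have "H * r powr (real p) \<le> 3 * Hf / 2 * r powr a"
      using mult_right_mono[OF less_imp_le[OF lt], of "r powr a"] by (simp add: split mult.assoc)
    then have "e * (H * r powr (real p)) \<le> e * (3 * Hf / 2 * r powr a)" using de by (intro mult_left_mono)
    then have "g \<le> (d + e) * (3 * Hf / 2 * r powr a)"
      using g by (simp add: distrib_right mult.assoc)
    also have "\<dots> \<le> 4 * (3 * Hf / 2 * r powr a)" using de Hf_nonneg by (intro mult_right_mono) auto
    finally show "g \<le> 4 * (3 * Hf / 2) * r powr (real p + \<nu> - 1)" by (simp add: a_def)
  qed
  have kr: "3 * Hf / 2 * r powr a \<le> H * r powr (real p)"
    using mult_right_mono[OF key, of "r powr a"] by (simp add: split mult.assoc)
  have "d * (3 * Hf / 2 * r powr a) \<le> d * (H * r powr (real p))"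
    using de kr by (intro mult_left_mono)
  then have "g \<le> (d + e) * (H * r powr (real p))"
    using g by (simp add: distrib_right mult.assoc)
  also have "\<dots> \<le> 4 * (H * r powr (real p))" using de H by (intro mult_right_mono) auto
  finally have g4: "g \<le> 4 * H * r powr (real p + 1 - 1)" by simp
  have ra: "r powr (a + 1) = r powr a * r" "r powr (real p + 1) = r powr (real p) * r"
    using rp by (simp_all add: powr_add)
  have "Hf * r powr (a + 1) \<le> 2 / 3 * (H * r powr (real p + 1))"
    using mult_right_mono[OF kr, of r] rp by (simp add: ra)
  then have "H / 3 * r powr (real p + 1) \<le> H * r powr (real p + 1) - Hf * r powr (a + 1)" by linarith
  then have "H / 3 * r powr (real p + 1) / fact p \<le> (H * r powr (real p + 1) - Hf * r powr (a + 1)) / fact p"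
    by (intro divide_right_mono) auto
  also have "\<dots> = H / fact p * r powr (real p + 1) - Hf / fact p * r powr (real p + \<nu>)"
    by (simp add: diff_divide_distrib a_def)
  also have "\<dots> \<le> f x - f y" using model_decrease[OF tr] by (simp add: r_def)
  finally have dec: "f x - f y \<ge> H / (3 * fact p) * r powr (real p + 1)" by simp
  have "(4::real) powr ((real p + 1) / (real p + 1 - 1)) \<le> 8 * (real p + 1) / 3"
    using p2 by (intro four_powr_bound) auto
  then show ?thesis
    using decrease_from_bounds[OF _ _ _ H _ _ g4 dec] p2 rp by (simp add: sufficient_decrease_def g_def)
qed

end

section \<open>Complexity\<close>

text \<open>If the search went past its initial parameter, the trial before the accepted one was
  rejected, so half the accepted parameter is below \<open>N\<close>. The halving in the update then
  keeps \<open>H t \<le> max H0 N\<close> invariant.\<close>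

lemma regularization_bound:
  assumes alg: "adaptive_tensor_method B f p \<alpha> \<theta> H0 x0 T x H xp it" and H0: "H0 > 0"
    and acc: "\<And>t i. t \<le> T \<Longrightarrow> i \<le> it t \<Longrightarrow> 2 ^ i * H t > 0 \<Longrightarrow> 2 ^ i * H t \<ge> N
      \<Longrightarrow> sufficient_decrease B f p \<alpha> (2 ^ i * H t) (x t) (xp t i)"
    and t: "t \<le> T"
  shows "0 < H t" "2 ^ it t * H t \<le> 2 * max H0 N"
proof -
  \<comment> \<open>The integer exponent is -1 when the first trial is accepted; in every case the
    update halves the accepted parameter.\<close>
  have half: "2 powi (int k - 1) * h = (2 ^ k * h) / 2" for k :: nat and h :: real
    by (simp add: power_int_diff)
  have it: "2 ^ it t * H t \<le> 2 * max H0 N" if t: "t \<le> T" and H: "0 < H t" "H t \<le> max H0 N" for t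
  proof (cases "it t")
    case 0 then show ?thesis using H by simp
  next
    case (Suc k)
    then have "\<not> sufficient_decrease B f p \<alpha> (2 ^ k * H t) (x t) (xp t k)"
      using alg t unfolding adaptive_tensor_method_def by simp
    then have "2 ^ k * H t < N" using acc[OF t, of k] Suc H by fastforce
    then show ?thesis using Suc by simp
  qed
  have bound: "0 < H t \<and> H t \<le> max H0 N" using t
  proof (induction t)
    case 0
    then show ?case using alg H0 by (simp add: adaptive_tensor_method_def)
  next
    case (Suc t)
    have "H (Suc t) = (2 ^ it t * H t) / 2"
      using alg Suc.prems half unfolding adaptive_tensor_method_def by simp
    moreover have "0 < 2 ^ it t * H t" using Suc by simp
    moreover have "2 ^ it t * H t \<le> 2 * max H0 N" using Suc it[of t] by simp
    ultimately show ?case by linarith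
  qed
  then show "0 < H t" "2 ^ it t * H t \<le> 2 * max H0 N" using it[OF t] by auto
qed

lemma iteration_count:
  fixes k q \<epsilon> G Y :: real
  assumes "k > 0" "q > 0" "\<epsilon> > 0" "G > 0" "Y > 0" and le: "\<epsilon> \<le> G powr q * Y / k powr q"
  shows "k \<le> G * (Y / \<epsilon>) powr (1 / q)"
proof -
  have "k powr q \<le> G powr q * (Y / \<epsilon>)" using assms by (simp add: field_simps)
  then have "(k powr q) powr (1 / q) \<le> (G powr q * (Y / \<epsilon>)) powr (1 / q)"
    using assms by (intro powr_mono2) auto
  moreover have "(k powr q) powr (1 / q) = k"
    using assms by (simp add: powr_powr)
  moreover have "(G powr q * (Y / \<epsilon>)) powr (1 / q) = G * (Y / \<epsilon>) powr (1 / q)"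
  proof -
    have "(G powr q * (Y / \<epsilon>)) powr (1 / q) = (G powr q) powr (1 / q) * (Y / \<epsilon>) powr (1 / q)"
      by (rule powr_mult)
    then show ?thesis using assms by (simp add: powr_powr)
  qed
  ultimately show ?thesis by (simp only:)
qed

theorem theorem3p4:
  fixes B :: "'a::euclidean_space \<Rightarrow> ('a \<Rightarrow>\<^sub>L real)"
    and f :: "'a \<Rightarrow> real"
    and p T m :: nat
    and \<nu> \<alpha> \<theta> \<epsilon> H0 D0 N :: real
    and x0 xs :: 'a
    and x :: "nat \<Rightarrow> 'a" and H :: "nat \<Rightarrow> real"
    and xp :: "nat \<Rightarrow> nat \<Rightarrow> 'a" and it :: "nat \<Rightarrow> nat"
    and known :: bool
  assumes "self_adjoint_pos_def B"
    and "p \<ge> 2"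
    and "convex_on UNIV f"
    and "times_differentiable p f"
    and "\<And>y. f xs \<le> f y"
    and "0 \<le> \<nu>" and "\<nu> \<le> 1"
    and "holder_const B f p \<nu> < \<infinity>"
    and "1 < D0"
    and "\<And>y. f y \<le> f x0 \<Longrightarrow> primal_norm B (y - xs) \<le> D0"
    and "\<alpha> = (if known then \<nu> else 1)"
    and "0 < \<epsilon>" and "\<epsilon> < 1"
    and "H0 > 0" and "\<theta> \<ge> 0"
    and "adaptive_tensor_method B f p \<alpha> \<theta> H0 x0 T x H xp it"
    and "f x0 - f xs \<ge> \<epsilon>"
    and "\<And>t i. t \<le> T \<Longrightarrow> i \<le> it t \<Longrightarrow> f (xp t i) - f xs \<ge> \<epsilon>"
    and "N = N_const known B f p \<nu> \<theta> xs \<epsilon>"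
    and "f (x m) - f xs
           \<le> (8 * fact (p + 1)) powr (real p + \<alpha> - 1) * 4 * max H0 N * D0 powr (real p + \<alpha>)"
    and "\<And>t. t < m \<Longrightarrow> \<not> f (x t) - f xs
           \<le> (8 * fact (p + 1)) powr (real p + \<alpha> - 1) * 4 * max H0 N * D0 powr (real p + \<alpha>)"
    and "m < T"
  shows "int m \<le> \<lceil>1 / ln ((real p + \<alpha>) / (real p + \<alpha> - 1))
           * ln (max 1 (log 2 ((f x0 - f xs)
               / ((8 * fact (p + 1)) powr (real p + \<alpha> - 1) * 2 * max H0 N
                   * D0 powr (real p + \<alpha>)))))\<rceil>
     \<and> f (x T) - f xs
         \<le> (24 * real p * fact (p + 1)) powr (real p + \<alpha> - 1) * 2 * max H0 N
             * D0 powr (real p + \<alpha>) / real (T - m) powr (real p + \<alpha> - 1)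
     \<and> real T \<le> real m + kappa1 known B f p \<nu> \<theta> H0 D0 * (24 * real p * fact (p + 1))
             * \<epsilon> powr (- 1 / (real p + \<nu> - 1))"
proof -
  note p2 = \<open>p \<ge> 2\<close> and D0 = \<open>1 < D0\<close> and D0_bound = assms(10)
    and alpha = assms(11) and eps = \<open>0 < \<epsilon>\<close> \<open>\<epsilon> < 1\<close> and H0 = \<open>H0 > 0\<close> and th = \<open>\<theta> \<ge> 0\<close>
    and alg = assms(16) and x0_eps = assms(17) and xp_eps = assms(18) and N_def = assms(19)
    and m1 = assms(20) and m2 = assms(21) and mT = \<open>m < T\<close>
  interpret holder_smooth B f p \<nu>
    by unfold_locales (use assms in auto)
  define q where "q = real p + \<alpha> - 1"
  have al: "0 \<le> \<alpha>" "\<alpha> \<le> 1" using alpha nu0 nu1 by auto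
  have q: "q \<ge> 1" "q \<le> real p" using p2 al by (auto simp: q_def)
  have q1: "real p + \<alpha> - 1 = q" "real p + \<alpha> = q + 1" by (auto simp: q_def)
  define R where "R = level_radius B f xs \<epsilon>"
  \<comment> \<open>The gap at \<open>x0\<close> is at least \<epsilon>, so the \<epsilon>-level set
    lies inside the initial level set. This bounds R(\<epsilon>) by \<open>D0\<close>.\<close>
  have level: "\<parallel>z - xs\<parallel> \<le> D0" if "f z \<le> f xs + \<epsilon>" for z
    using that x0_eps by (intro D0_bound) simp
  then have bdd: "bdd_above {\<parallel>z - xs\<parallel> | z. f z \<le> f xs + \<epsilon>}"
    by (auto intro!: bdd_aboveI[of _ D0])
  have RD: "R \<le> D0"
    unfolding R_def level_radius_def using level eps by (intro cSup_least) (auto intro: exI[of _ xs])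
  have Rp: "R > 0" unfolding R_def by (rule grad_lower_level(1)[OF eps(1) x0_eps bdd])
  have N: "N = (if known then max (3 * Hf / 2) (3 * \<theta> * fact (p - 1))
      else max \<theta> ((3 * Hf / 2) powr (real p / (real p + \<nu> - 1)) * (4 * R / \<epsilon>) powr ((1 - \<nu>) / (real p + \<nu> - 1))))"
    by (simp add: N_def N_const_def Hf_def R_def Let_def)
  have trial: "trial_point B f p \<alpha> \<theta> (2 ^ i * H t) (x t) (xp t i)" if "t \<le> T" "i \<le> it t" for t i
    using alg that by (simp add: adaptive_tensor_method_def)
  have acc: "sufficient_decrease B f p \<alpha> (2 ^ i * H t) (x t) (xp t i)"
    if ti: "t \<le> T" "i \<le> it t" and h: "2 ^ i * H t > 0" "2 ^ i * H t \<ge> N" for t i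
  proof (cases known)
    case True
    then show ?thesis using accept_known[of \<theta> "2 ^ i * H t"] trial[OF ti] h N alpha by simp
  next
    case False
    then show ?thesis
      using accept_unknown[OF _ h(1) th _ R_def _ eps(1) xp_eps[OF ti] bdd] trial[OF ti] h N alpha by simp
  qed
  note reg = regularization_bound[OF alg H0 acc]
  define M where "M = 2 * max H0 N"
  have M: "M > 0" using H0 by (simp add: M_def)
  have x_Suc: "x (Suc t) = xp t (it t)" if "t < T" for t
    using alg that by (simp add: adaptive_tensor_method_def)
  have x_0: "x 0 = x0" using alg by (simp add: adaptive_tensor_method_def)
  define \<delta> where "\<delta> t = f (x t) - f xs" for t
  have delta_eps: "\<delta> t \<ge> \<epsilon>" if "t \<le> T" for t
  proof (cases t)
    case 0 then show ?thesis using x0_eps x_0 by (simp add: \<delta>_def)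
  next
    case (Suc k) then show ?thesis using that xp_eps[of k "it k"] x_Suc[of k] by (simp add: \<delta>_def)
  qed
  define P where "P = (8 * fact (p + 1) :: real)"
  have P: "P > 0" by (simp add: P_def)
  have e1: "(q + 1) / q = 1 + 1 / q" using q by (simp add: field_simps)
  \<comment> \<open>The accepted parameter is replaced by its upper bound \<open>M\<close>, giving
    one constant for all iterations.\<close>
  have suff: "\<delta> t - \<delta> (Suc t) \<ge> 1 / (P * M powr (1 / q)) * dual_norm B (grad f (x (Suc t))) powr (1 + 1 / q)"
    if t: "t < T" for t
  proof -
    have tT: "t \<le> T" using t by simp
    let ?h = "2 ^ it t * H t"
    have h: "0 < ?h" "?h \<le> M" using reg[OF _ _ _ _ tT] by (auto simp: M_def)
    have "sufficient_decrease B f p \<alpha> ?h (x t) (x (Suc t))"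
      using alg tT x_Suc[OF t] by (simp add: adaptive_tensor_method_def)
    then have "\<delta> t - \<delta> (Suc t) \<ge> 1 / (P * ?h powr (1 / q)) * dual_norm B (grad f (x (Suc t))) powr (1 + 1 / q)"
      unfolding sufficient_decrease_def unfolding q1(1) unfolding q1(2) e1 by (simp only: \<delta>_def P_def diff_diff_eq2 diff_add_cancel)
    moreover have "1 / (P * M powr (1 / q)) \<le> 1 / (P * ?h powr (1 / q))"
      using h M P q by (intro divide_left_mono mult_left_mono powr_mono2 mult_pos_pos) auto
    ultimately show ?thesis
      by (meson mult_right_mono order_trans powr_ge_zero)
  qed
  have mono: "f (x t) \<le> f x0" if "t \<le> T" for t
    using that
  proof (induction t)
    case (Suc t)
    have "0 \<le> 1 / (P * M powr (1 / q)) * dual_norm B (grad f (x (Suc t))) powr (1 + 1 / q)"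
      using P by simp
    then have "\<delta> (Suc t) \<le> \<delta> t" using suff[of t] Suc.prems by linarith
    then show ?case using Suc by (simp add: \<delta>_def)
  qed (simp add: x_0)
  \<comment> \<open>The scale is chosen to make the recursion constant 1:
    \<open>A powr (1 / q)\<close> equals \<open>P * M powr (1 / q) * D0 powr (1 + 1 / q)\<close>,
    the factor that the test and the distance bound produce.\<close>
  define A where "A = P powr q * M * D0 powr (q + 1)"
  have A: "A > 0" using P M D0 by (simp add: A_def)
  define u where "u t = \<delta> t / A" for t
  have u_pos: "u t > 0" if "t \<le> T" for t
    using delta_eps[OF that] eps A by (simp add: u_def)
  have rec: "u (Suc t) + u (Suc t) powr (1 + 1 / q) \<le> u t" if t: "t < T" for t
  proof -
    have St: "Suc t \<le> T" using t by simp
    define g where "g = dual_norm B (grad f (x (Suc t)))"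
    define d where "d = \<delta> (Suc t)"
    have d: "d > 0" using delta_eps[OF St] eps by (simp add: d_def)
    \<comment> \<open>Convexity converts the remaining gap into a lower bound on the gradient;
      monotonicity of the iterates keeps the distance to \<open>xs\<close> within
      \<open>D0\<close>.\<close>
    have "d \<le> g * \<parallel>x (Suc t) - xs\<parallel>"
      using grad_lower by (simp add: d_def \<delta>_def g_def)
    also have "\<dots> \<le> g * D0" using D0_bound[OF mono[OF St]] by (intro mult_left_mono) (auto simp: g_def)
    finally have "d / D0 \<le> g" using D0 by (simp add: field_simps)
    then have "(d / D0) powr (1 + 1 / q) \<le> g powr (1 + 1 / q)"
      using d D0 q by (intro powr_mono2) auto
    then have "1 / (P * M powr (1 / q)) * (d / D0) powr (1 + 1 / q) \<le> 1 / (P * M powr (1 / q)) * g powr (1 + 1 / q)"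
      using P by (intro mult_left_mono) auto
    also have "\<dots> \<le> \<delta> t - d" using suff[OF t] by (simp add: d_def g_def)
    finally have le: "1 / (P * M powr (1 / q)) * (d / D0) powr (1 + 1 / q) \<le> \<delta> t - d" .
    have Aq: "A powr (1 / q) = P * M powr (1 / q) * D0 powr (1 + 1 / q)"
      using P M D0 q by (simp add: A_def powr_mult powr_powr add_divide_distrib)
    have "u (Suc t) powr (1 + 1 / q) = d powr (1 + 1 / q) / (A * A powr (1 / q))"
      using d A by (simp add: u_def d_def powr_divide powr_add)
    also have "\<dots> = 1 / (P * M powr (1 / q)) * (d / D0) powr (1 + 1 / q) / A"
      using d D0 by (simp add: Aq powr_divide)
    also have "\<dots> \<le> (\<delta> t - d) / A" using le A by (intro divide_right_mono) auto
    finally show ?thesis by (simp add: u_def d_def diff_divide_distrib)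
  qed
  \<comment> \<open>\<open>M\<close> already carries one of the two factors 2 in the constant 4, so
    the level that defines \<open>m\<close> is \<open>u = 2\<close>.\<close>
  have lvl: "(8 * fact (p + 1)) powr (real p + \<alpha> - 1) * 4 * max H0 N * D0 powr (real p + \<alpha>) = 2 * A"
    unfolding q1(1) unfolding q1(2) A_def P_def M_def by simp
  have um: "u m \<le> 2" using m1 A unfolding lvl by (simp add: u_def \<delta>_def field_simps)
  have u_big: "u t > 2" if "t < m" for t
    using m2[OF that] A unfolding lvl by (simp add: u_def \<delta>_def field_simps)

  have "int m \<le> \<lceil>1 / ln ((q + 1) / q) * ln (max 1 (log 2 (u 0)))\<rceil>"
  proof (rule superlinear_phase)
    fix t assume "Suc t < m"
    then show "u (Suc t) powr (1 + 1 / q) \<le> u t"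
      using rec[of t] u_pos[of "Suc t"] mT by simp
  qed (use q u_big in auto)
  also have "u 0 = (f x0 - f xs) / ((8 * fact (p + 1)) powr q * 2 * max H0 N * D0 powr (q + 1))"
    by (simp add: u_def \<delta>_def x_0 A_def P_def M_def mult.assoc)
  finally have c1: "int m \<le> \<lceil>1 / ln ((real p + \<alpha>) / (real p + \<alpha> - 1))
           * ln (max 1 (log 2 ((f x0 - f xs)
               / ((8 * fact (p + 1)) powr (real p + \<alpha> - 1) * 2 * max H0 N
                   * D0 powr (real p + \<alpha>)))))\<rceil>"
    unfolding q1(1) unfolding q1(2) .

  define k where "k = real (T - m)"
  have k: "k > 0" using mT by (simp add: k_def)
  define G where "G = 24 * real p * fact (p + 1)"
  have G: "G > 0" "G = 3 * real p * P" using p2 by (auto simp: G_def P_def)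
  define Y where "Y = 2 * max H0 N * D0 powr (q + 1)"
  have Y: "Y > 0" using H0 D0 by (simp add: Y_def)
  have AY: "A = P powr q * Y" by (simp add: A_def Y_def M_def)
  have "u T \<le> (3 * q / k) powr q"
    unfolding k_def using q um u_pos rec mT by (intro sublinear_phase) auto
  \<comment> \<open>Weakening 3 q to 3 p produces the stated constant: 3 p times 8 (p + 1)! is 24 p
    (p + 1)!.\<close>
  also have "\<dots> \<le> (3 * real p / k) powr q"
    using q k by (intro powr_mono2) (auto intro!: divide_right_mono)
  finally have "\<delta> T \<le> (3 * real p / k) powr q * A" using A by (simp add: u_def field_simps)
  also have "\<dots> = G powr q * Y / k powr q"
    using P k by (simp add: AY G powr_mult powr_divide)
  finally have dT: "\<delta> T \<le> G powr q * Y / k powr q" .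
  then have c2: "f (x T) - f xs
         \<le> (24 * real p * fact (p + 1)) powr (real p + \<alpha> - 1) * 2 * max H0 N
             * D0 powr (real p + \<alpha>) / real (T - m) powr (real p + \<alpha> - 1)"
    unfolding q1(1) unfolding q1(2) by (simp add: \<delta>_def G_def Y_def k_def mult.assoc)

  have "\<epsilon> \<le> G powr q * Y / k powr q" using delta_eps[of T] dT by simp
  then have kle: "k \<le> G * (Y / \<epsilon>) powr (1 / q)"
    using k q eps G Y by (intro iteration_count) auto
  have kap: "(Y / \<epsilon>) powr (1 / q) \<le> kappa1 known B f p \<nu> \<theta> H0 D0 * \<epsilon> powr (- 1 / (real p + \<nu> - 1))"
  proof (cases known)
    case True
    then have "kappa1 known B f p \<nu> \<theta> H0 D0 = Y powr (1 / q)"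
      using alpha N by (simp add: kappa1_def Hf_def Let_def Y_def q_def)
    moreover have "- 1 / (real p + \<nu> - 1) = - (1 / q)" using True alpha by (simp add: q_def)
    ultimately show ?thesis by (simp add: powr_divide powr_minus_divide)
  next
    case False
    define a where "a = real p + \<nu> - 1"
    define b where "b = (1 - \<nu>) / a"
    have a: "a > 0" using p2 nu0 by (simp add: a_def)
    have b: "b \<ge> 0" using a nu1 by (simp add: b_def)
    have qp: "q = real p" using False alpha by (simp add: q_def)
    define S where "S = (3 * Hf / 2) powr (real p / a)"
    have S: "S \<ge> 0" by (simp add: S_def)
    define L where "L = max H0 (max \<theta> (S * (4 * D0) powr b))"
    \<comment> \<open>\<open>N\<close> depends on \<epsilon> through
      \<open>(4 * R / \<epsilon>) powr b\<close>. The factor \<open>Z\<close> isolates this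
      dependence; as \<epsilon> < 1 gives \<open>Z \<ge> 1\<close>, the entries \<open>H0\<close>
      and \<theta> of the maximum are absorbed too.\<close>
    define Z where "Z = \<epsilon> powr (- b)"
    have Z: "Z \<ge> 1" using powr_mono'[of "- b" 0 \<epsilon>] eps b by (simp add: Z_def)
    have "(4 * R / \<epsilon>) powr b \<le> (4 * D0 / \<epsilon>) powr b"
      using Rp RD eps b by (intro powr_mono2 divide_right_mono) auto
    also have "\<dots> = (4 * D0) powr b * Z"
      by (simp add: Z_def powr_divide powr_minus_divide)
    finally have "S * (4 * R / \<epsilon>) powr b \<le> S * (4 * D0) powr b * Z"
      using S by (simp add: mult.assoc mult_left_mono)
    also have "\<dots> \<le> L * Z" using Z by (intro mult_right_mono) (auto simp: L_def)
    finally have 1: "S * (4 * R / \<epsilon>) powr b \<le> L * Z" .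
    have "L > 0" using H0 by (simp add: L_def)
    then have "L \<le> L * Z" using Z by simp
    then have 2: "H0 \<le> L * Z" "\<theta> \<le> L * Z" unfolding L_def by linarith+
    have "max H0 N \<le> L * Z" using 1 2 N False by (simp add: S_def a_def b_def)
    then have "Y \<le> 2 * (L * Z) * D0 powr (q + 1)"
      unfolding Y_def using D0 by (intro mult_right_mono mult_left_mono) auto
    then have "(Y / \<epsilon>) powr (1 / q) \<le> (2 * (L * Z) * D0 powr (q + 1) / \<epsilon>) powr (1 / q)"
      using Y eps q by (intro powr_mono2 divide_right_mono) auto
    also have "2 * (L * Z) * D0 powr (q + 1) / \<epsilon> = (2 * L * D0 ^ (p + 1)) * \<epsilon> powr (- b - 1)"
    proof -
      have "D0 powr (q + 1) = D0 ^ (p + 1)" using D0 powr_realpow[of D0 "p + 1"] by (simp add: qp add.commute)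
      moreover have "Z / \<epsilon> = \<epsilon> powr (- b - 1)" using eps by (simp add: Z_def powr_diff)
      ultimately show ?thesis by (metis (no_types, opaque_lifting) mult.assoc mult.commute times_divide_eq_right)
    qed
    also have "\<dots> powr (1 / q) = (2 * L * D0 ^ (p + 1)) powr (1 / q) * \<epsilon> powr ((- b - 1) * (1 / q))"
      using \<open>L > 0\<close> D0 eps by (simp add: powr_mult powr_powr)
    \<comment> \<open>The \<epsilon> inside \<open>N\<close> and the \<epsilon> of the target
      accuracy combine: b + 1 = p / a, and the root of order q = p leaves 1 / a. Thus both variants
      share the same rate in \<epsilon>.\<close>
    also have "(- b - 1) * (1 / q) = - 1 / a"
    proof -
      have "real p = (1 - \<nu>) + a" by (simp add: a_def)
      then have "- b - 1 = - (real p / a)" using a by (simp add: b_def add_divide_distrib)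
      then show ?thesis using p2 by (simp add: qp)
    qed
    also have "(2 * L * D0 ^ (p + 1)) powr (1 / q) = kappa1 known B f p \<nu> \<theta> H0 D0"
      using False by (simp add: kappa1_def Hf_def Let_def L_def S_def a_def b_def qp)
    finally show ?thesis by (simp add: a_def)
  qed
  have "k \<le> kappa1 known B f p \<nu> \<theta> H0 D0 * G * \<epsilon> powr (- 1 / (real p + \<nu> - 1))"
    using kle mult_left_mono[OF kap, of G] G by (simp add: mult_ac)
  then have c3: "real T \<le> real m + kappa1 known B f p \<nu> \<theta> H0 D0 * (24 * real p * fact (p + 1))
             * \<epsilon> powr (- 1 / (real p + \<nu> - 1))"
    unfolding G_def k_def using mT by (simp add: of_nat_diff)
  show ?thesis using c1 c2 c3 by blast
qed

end
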